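(* Let $N,K,M\ge 1$ be integers with $K\le N$, and let $\mathfrak{T}$ be an arbitrary collusion pattern on the set of servers $\{1,\dots,N\}$, i.e. a family of subsets of $\{1,\dots,N\}$ closed under taking subsets. Suppose that $\mathfrak{B}=\{\mathcal{B}_1,\mathcal{B}_2,\dots,\mathcal{B}_b\}$ is a family of $K$-subsets of $\{1,\dots,N\}$ such that every $\mathcal{T}\in\mathfrak{T}$ has non-empty intersection with at most $\Delta$ of the subsets in $\mathfrak{B}$. If $b>\Delta$, then, for every sufficiently large prime power $q$ and every generator matrix $\mathbf{G}\in\mathbb{F}_q^{K\times N}$ of an $(N,K)$-MDS code, there exist a positive integer $L$ and an $(N,K;M)$-PIR scheme with respect to the collusion pattern $\mathfrak{T}$, for $M$ files in $\mathbb{F}_q^{L\times K}$ stored via $\mathbf{G}$, whose rate is $$\left(1+R+R^2+\cdots+R^{M-1}\right)^{-1},\qquad\text{where } R=\frac{\Delta}{b}.$$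
   Context: Storage. There are $N$ servers and $M$ files $W^{[1]},\dots,W^{[M]}\in\mathbb{F}_q^{L\times K}$, independent and uniformly distributed (entropies are in $q$-ary units, so $H(W^{[i]})=LK$ and $H(W^{[1]},\dots,W^{[M]})=MLK$). Let $\mathbf{G}=[\mathbf{g}_1\ \cdots\ \mathbf{g}_N]\in\mathbb{F}_q^{K\times N}$ have the MDS property: any $K$ columns are linearly independent. Server $n$ stores $\mathbf{y}_n=(W^{[1]}\mathbf{g}_n,\dots,W^{[M]}\mathbf{g}_n)\in\mathbb{F}_q^{ML}$. $(N,K;M)$-PIR scheme with respect to $\mathfrak{T}$. The user wants file $W^{[i]}$. There is a random variable $\mathcal{F}$ (the user's randomness for generating queries, unknown to the servers) and a random variable $\mathcal{G}$ (the servers' randomness for producing feedbacks, also known to the user; it may be deterministic); $\mathcal{F},\mathcal{G},i,W^{[1]},\dots,W^{[M]}$ are mutually independent. Using $\mathcal F$, the user generates queries $Q^{[i]}_1,\dots,Q^{[i]}_N$, with $Q^{[i]}_n$ sent to server $n$, such that $I(Q^{[i]}_1,\dots,Q^{[i]}_N;W^{[1]},\dots,W^{[M]})=0$. The feedback $A^{[i]}_n$ of server $n$ is a deterministic function of $Q^{[i]}_n,\mathcal{G},\mathbf{y}_n$. The requirements are: - Correctness: $H(W^{[i]}\mid Q^{[i]}_1,\dots,Q^{[i]}_N,A^{[i]}_1,\dots,A^{[i]}_N,\mathcal{F},\mathcal{G})=0$. - Privacy against $\mathfrak{T}$: for every $\mathcal{T}\in\mathfrak{T}$, $I(i;Q^{[i]}_{\mathcal{T}})=I(i;A^{[i]}_{\mathcal{T}})=0$,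 where $Q^{[i]}_{\mathcal{T}}=\{Q^{[i]}_n:n\in\mathcal{T}\}$ and $A^{[i]}_{\mathcal{T}}=\{A^{[i]}_n:n\in\mathcal{T}\}$. Rate: $H(W^{[i]})/\sum_{n=1}^N H(A^{[i]}_n)$. *)

theory Defs
  imports "HOL-Probability.Probability" "HOL-Algebra.Ring"
begin

section \<open>Shannon information on finite probability spaces\<close>

text \<open>
  The support of a finitely supported pmf as a finite sample space.  Restricting to the support
  makes every function on it a simple random variable, so that the notions of the information
  theory library below are the ordinary finite Shannon quantities (for base \<open>b > 1\<close>).
\<close>

definition finite_space :: "'s pmf \<Rightarrow> 's measure" where
  "finite_space p = point_measure (set_pmf p) (\<lambda>x. ennreal (pmf p x))"

definition Ent :: "real \<Rightarrow> 's pmf \<Rightarrow> ('s \<Rightarrow> 'x) \<Rightarrow> real" where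
  "Ent b p X = prob_space.entropy (finite_space p) b (count_space (X ` set_pmf p)) X"

definition Cond_Ent :: "real \<Rightarrow> 's pmf \<Rightarrow> ('s \<Rightarrow> 'x) \<Rightarrow> ('s \<Rightarrow> 'y) \<Rightarrow> real" where
  "Cond_Ent b p X Y =
     prob_space.conditional_entropy (finite_space p) b
       (count_space (X ` set_pmf p)) (count_space (Y ` set_pmf p)) X Y"

definition Mut_Inf :: "real \<Rightarrow> 's pmf \<Rightarrow> ('s \<Rightarrow> 'x) \<Rightarrow> ('s \<Rightarrow> 'y) \<Rightarrow> real" where
  "Mut_Inf b p X Y =
     prob_space.mutual_information (finite_space p) b
       (count_space (X ` set_pmf p)) (count_space (Y ` set_pmf p)) X Y"


section \<open>MDS coded storage\<close>

text \<open>
  The field is a HOL-Algebra structure rather than a type, so that statements can quantify over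
  all finite fields.  Matrices are functions of a row and a column index, both counted from 1;
  \<open>G k n\<close> is the \<open>k\<close>-th entry of the column of server \<open>n\<close>.
\<close>

definition mds_matrix :: "('a, 'm) ring_scheme \<Rightarrow> nat \<Rightarrow> nat \<Rightarrow> (nat \<Rightarrow> nat \<Rightarrow> 'a) \<Rightarrow> bool" where
  "mds_matrix F N K G \<longleftrightarrow>
     (\<forall>k\<in>{1..K}. \<forall>n\<in>{1..N}. G k n \<in> carrier F) \<and>
     (\<forall>S. S \<subseteq> {1..N} \<and> card S = K \<longrightarrow>
        (\<forall>c. c \<in> S \<rightarrow> carrier F \<longrightarrow>
             (\<forall>k\<in>{1..K}. (\<Oplus>\<^bsub>F\<^esub>n\<in>S. c n \<otimes>\<^bsub>F\<^esub> G k n) = \<zero>\<^bsub>F\<^esub>) \<longrightarrow>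
             (\<forall>n\<in>S. c n = \<zero>\<^bsub>F\<^esub>)))"

text \<open>\<open>W j l k\<close> is the entry in row \<open>l\<close> and column \<open>k\<close> of the \<open>j\<close>-th file.\<close>

type_synonym 'a files = "nat \<Rightarrow> nat \<Rightarrow> nat \<Rightarrow> 'a"

definition all_files :: "('a, 'm) ring_scheme \<Rightarrow> nat \<Rightarrow> nat \<Rightarrow> nat \<Rightarrow> 'a files set" where
  "all_files F K M L = {1..M} \<rightarrow>\<^sub>E {1..L} \<rightarrow>\<^sub>E {1..K} \<rightarrow>\<^sub>E carrier F"

text \<open>Content of server \<open>n\<close>: the \<open>j\<close>-th component is the product of file \<open>j\<close> and column \<open>n\<close>.\<close>

definition stored ::
  "('a, 'm) ring_scheme \<Rightarrow> nat \<Rightarrow> nat \<Rightarrow> nat \<Rightarrow> (nat \<Rightarrow> nat \<Rightarrow> 'a) \<Rightarrow> 'a files \<Rightarrow> nat \<Rightarrow> (nat \<Rightarrow> nat \<Rightarrow> 'a)"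
where
  "stored F K M L G W n =
     (\<lambda>j\<in>{1..M}. \<lambda>l\<in>{1..L}. \<Oplus>\<^bsub>F\<^esub>k\<in>{1..K}. W j l k \<otimes>\<^bsub>F\<^esub> G k n)"


section \<open>PIR schemes\<close>

text \<open>
  \<open>query s i n f\<close> is the query sent to server \<open>n\<close> when file \<open>i\<close> is wanted and the user's randomness
  takes the value \<open>f\<close>; \<open>feedback s n x g y\<close> is the feedback of server \<open>n\<close> with content \<open>y\<close> to
  the query \<open>x\<close> when the servers' randomness takes the value \<open>g\<close>.  In particular the feedback
  depends on the wanted file only through the query.
\<close>

record ('f, 'g, 'x, 'r, 'a) pir_scheme =
  user_rand :: "'f pmf"
  server_rand :: "'g pmf"
  query :: "nat \<Rightarrow> nat \<Rightarrow> 'f \<Rightarrow> 'x"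
  feedback :: "nat \<Rightarrow> 'x \<Rightarrow> 'g \<Rightarrow> (nat \<Rightarrow> nat \<Rightarrow> 'a) \<Rightarrow> 'r"

text \<open>
  Joint law of the user's randomness, the servers' randomness and the files: these are independent,
  and the uniform distribution on \<open>all_files\<close> makes the files independent and uniform.
\<close>

definition pir_law ::
  "('a, 'm) ring_scheme \<Rightarrow> nat \<Rightarrow> nat \<Rightarrow> nat \<Rightarrow> ('f, 'g, 'x, 'r, 'a) pir_scheme
     \<Rightarrow> ('f \<times> 'g \<times> 'a files) pmf"
where
  "pir_law F K M L s =
     pair_pmf (user_rand s) (pair_pmf (server_rand s) (pmf_of_set (all_files F K M L)))"

text \<open>The queries \<open>Q\<^sub>T\<close> and the feedbacks \<open>A\<^sub>T\<close> of the servers in \<open>T\<close> when file \<open>i\<close> is wanted.\<close>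

definition queries ::
  "('f, 'g, 'x, 'r, 'a) pir_scheme \<Rightarrow> nat \<Rightarrow> nat set \<Rightarrow> 'f \<times> 'g \<times> 'a files \<Rightarrow> (nat \<Rightarrow> 'x)"
where
  "queries s i T = (\<lambda>(f, g, W). \<lambda>n\<in>T. query s i n f)"

definition feedbacks ::
  "('a, 'm) ring_scheme \<Rightarrow> nat \<Rightarrow> nat \<Rightarrow> nat \<Rightarrow> (nat \<Rightarrow> nat \<Rightarrow> 'a) \<Rightarrow> ('f, 'g, 'x, 'r, 'a) pir_scheme
     \<Rightarrow> nat \<Rightarrow> nat set \<Rightarrow> 'f \<times> 'g \<times> 'a files \<Rightarrow> (nat \<Rightarrow> 'r)"
where
  "feedbacks F K M L G s i T =
     (\<lambda>(f, g, W). \<lambda>n\<in>T. feedback s n (query s i n f) g (stored F K M L G W n))"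

text \<open>
  For privacy, the index of the wanted file is a random variable, independent of everything else,
  with an arbitrary distribution \<open>d\<close> on \<open>{1..M}\<close>.
\<close>

definition is_pir_scheme ::
  "('a, 'm) ring_scheme \<Rightarrow> nat \<Rightarrow> nat \<Rightarrow> nat \<Rightarrow> nat \<Rightarrow> (nat \<Rightarrow> nat \<Rightarrow> 'a) \<Rightarrow> nat set set
     \<Rightarrow> ('f, 'g, 'x, 'r, 'a) pir_scheme \<Rightarrow> bool"
where
  "is_pir_scheme F N K M L G \<TT> s \<longleftrightarrow>
     (let q = real (card (carrier F));
          P = pir_law F K M L s;
          Q = queries s;
          A = feedbacks F K M L G s
      in finite (set_pmf (user_rand s)) \<and> finite (set_pmf (server_rand s)) \<and>
         (\<forall>i\<in>{1..M}. Mut_Inf q P (Q i {1..N}) (\<lambda>(f, g, W). W) = 0) \<and>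
         (\<forall>i\<in>{1..M}.
            Cond_Ent q P (\<lambda>(f, g, W). W i)
              (\<lambda>(f, g, W). (Q i {1..N} (f, g, W), A i {1..N} (f, g, W), f, g)) = 0) \<and>
         (\<forall>T\<in>\<TT>. \<forall>d. set_pmf d \<subseteq> {1..M} \<longrightarrow>
            Mut_Inf q (pair_pmf d P) fst (\<lambda>(i, \<omega>). Q i T \<omega>) = 0 \<and>
            Mut_Inf q (pair_pmf d P) fst (\<lambda>(i, \<omega>). A i T \<omega>) = 0))"

definition pir_rate ::
  "('a, 'm) ring_scheme \<Rightarrow> nat \<Rightarrow> nat \<Rightarrow> nat \<Rightarrow> nat \<Rightarrow> (nat \<Rightarrow> nat \<Rightarrow> 'a)
     \<Rightarrow> ('f, 'g, 'x, 'r, 'a) pir_scheme \<Rightarrow> nat \<Rightarrow> real"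
where
  "pir_rate F N K M L G s i =
     (let q = real (card (carrier F)); P = pir_law F K M L s
      in Ent q P (\<lambda>(f, g, W). W i) /
         (\<Sum>n=1..N. Ent q P (\<lambda>\<omega>. feedbacks F K M L G s i {n} \<omega> n)))"

definition collusion_pattern :: "nat \<Rightarrow> nat set set \<Rightarrow> bool" where
  "collusion_pattern N \<TT> \<longleftrightarrow> \<TT> \<subseteq> Pow {1..N} \<and> (\<forall>T\<in>\<TT>. \<forall>S. S \<subseteq> T \<longrightarrow> S \<in> \<TT>)"

end

theory Submission
  imports Defs "HOL-Algebra.Multiplicative_Group"
begin

text \<open>
  Sending the same query to all \<open>K\<close> servers of a block reveals, by the MDS property, the queried
  combination of the rows of the files themselves.  So every block acts as one virtual server that
  stores all the files, and a collusion set sees the queries of at most \<open>\<Delta>\<close> of the \<open>b\<close> virtual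
  servers.  On these we run a scheme in the style of Sun and Jafar.

  Take \<open>L = (b - \<Delta>) b ^ M\<close> and apply to the rows of each file a uniformly random linear bijection.
  The resulting rows of file \<open>j\<close> are indexed by the pairs of a virtual server \<open>v\<close> and a word \<open>w\<close>
  of length \<open>M\<close> over \<open>{..<b}\<close> with \<open>w j \<ge> \<Delta>\<close>.  For every word \<open>w\<close> with such a letter, \<open>v\<close> is asked
  for a sum over the files \<open>j\<close> with \<open>w j \<ge> \<Delta>\<close>.  The wanted file enters with its row \<open>(v, w)\<close>.
  An unwanted file enters with a coordinate of a codeword of a \<open>(b, \<Delta>)\<close>-MDS code; exactly \<open>\<Delta>\<close>
  coordinates of each codeword occur in queries without the wanted file, so the others can be
  computed and subtracted from the queries with the wanted file.  Any \<open>\<Delta>\<close> virtual servers see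
  the same coordinates of a uniformly random linear bijection whether or not a file is wanted.
  All combinations asked for are linearly independent, hence the answers are uniform, and the rate is
  \<open>L K / (b K (b ^ M - \<Delta> ^ M))\<close>.
\<close>

section \<open>Information quantities of finite probability spaces\<close>

lemma space_finite_space [simp]: "space (finite_space p) = set_pmf p"
  by (simp add: finite_space_def space_point_measure)

lemma emeasure_finite_space:
  assumes "finite (set_pmf p)" "A \<subseteq> set_pmf p"
  shows "emeasure (finite_space p) A = emeasure (measure_pmf p) A"
proof -
  have "finite A" using assms finite_subset by blast
  then show ?thesis
    using assms by (simp add: finite_space_def emeasure_point_measure_finite
        emeasure_measure_pmf_finite)
qed

lemma prob_space_finite_space:
  assumes "finite (set_pmf p)"
  shows "prob_space (finite_space p)"
  by (rule prob_spaceI) (simp add: emeasure_finite_space assms emeasure_pmf)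

lemma prob_finite_space:
  assumes "finite (set_pmf p)"
  shows "measure (finite_space p) (X -` {x} \<inter> set_pmf p) = pmf (map_pmf X p) x"
  using assms
  by (simp add: measure_def emeasure_finite_space pmf_map emeasure_Int_set_pmf)

lemma information_space_finite_space:
  assumes "finite (set_pmf p)" "1 < b"
  shows "information_space (finite_space p) b"
  using prob_space_finite_space[OF assms(1)] assms(2)
  by (simp add: information_space_def information_space_axioms_def)

lemma simple_function_finite_space:
  assumes "finite (set_pmf p)"
  shows "simple_function (finite_space p) X"
  using assms by (simp add: finite_space_def)

lemma simple_distributed_finite_space:
  assumes "finite (set_pmf p)"
  shows "simple_distributed (finite_space p) X (pmf (map_pmf X p))"
proof -
  interpret prob_space "finite_space p" by (rule prob_space_finite_space[OF assms])
  show ?thesis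
    by (rule simple_distributedI)
      (simp_all add: assms simple_function_finite_space prob_finite_space)
qed

text \<open>Independence enters as a product form of the joint law. The factors may be any laws:
  projecting the product identifies them as the marginals.\<close>

lemma Mut_Inf_eq_0:
  assumes fin: "finite (set_pmf p)" and b: "1 < b"
    and indep: "map_pmf (\<lambda>\<omega>. (X \<omega>, Y \<omega>)) p = pair_pmf A B"
  shows "Mut_Inf b p X Y = 0"
proof -
  have "map_pmf X p = A" "map_pmf Y p = B"
    using arg_cong[OF indep, of "map_pmf fst"] arg_cong[OF indep, of "map_pmf snd"]
    by (simp_all add: pmf.map_comp o_def map_fst_pair_pmf map_snd_pair_pmf)
  note marginals = this
  interpret information_space "finite_space p" b
    by (rule information_space_finite_space[OF fin b])
  show ?thesis
    using mutual_information_eq_0_simple[OF simple_distributed_finite_space[OF fin]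
        simple_distributed_finite_space[OF fin] simple_distributed_finite_space[OF fin], of X Y]
    by (simp add: Mut_Inf_def indep marginals pmf_pair)
qed

text \<open>If \<open>Y\<close> determines \<open>X\<close> on the support, the pair
  \<open>(X, Y)\<close> and \<open>Y\<close> alone have the same point masses, so every term of the
  conditional entropy contains the logarithm of 1.\<close>

lemma Cond_Ent_eq_0:
  assumes fin: "finite (set_pmf p)" and b: "1 < b"
    and det: "\<And>\<omega> \<omega>'. \<omega> \<in> set_pmf p \<Longrightarrow> \<omega>' \<in> set_pmf p \<Longrightarrow> Y \<omega> = Y \<omega>' \<Longrightarrow> X \<omega> = X \<omega>'"
  shows "Cond_Ent b p X Y = 0"
proof -
  interpret information_space "finite_space p" b
    by (rule information_space_finite_space[OF fin b])
  have eq: "pmf (map_pmf (\<lambda>\<omega>. (X \<omega>, Y \<omega>)) p) (X \<omega>, Y \<omega>) = pmf (map_pmf Y p) (Y \<omega>)"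
    if "\<omega> \<in> set_pmf p" for \<omega>
  proof -
    have "(\<lambda>\<omega>. (X \<omega>, Y \<omega>)) -` {(X \<omega>, Y \<omega>)} \<inter> set_pmf p = Y -` {Y \<omega>} \<inter> set_pmf p"
      using that by (auto intro: det)
    then show ?thesis
      using prob_finite_space[OF fin, of "\<lambda>\<omega>. (X \<omega>, Y \<omega>)" "(X \<omega>, Y \<omega>)"]
        prob_finite_space[OF fin, of Y "Y \<omega>"] by simp
  qed
  have pos: "pmf (map_pmf Y p) (Y \<omega>) > 0" if "\<omega> \<in> set_pmf p" for \<omega>
    using that by (intro pmf_positive) simp
  have "pmf (map_pmf (\<lambda>\<omega>. (X \<omega>, Y \<omega>)) p) (X \<omega>, Y \<omega>) *
      log b (pmf (map_pmf (\<lambda>\<omega>. (X \<omega>, Y \<omega>)) p) (X \<omega>, Y \<omega>) / pmf (map_pmf Y p) (Y \<omega>)) = 0"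
    if "\<omega> \<in> set_pmf p" for \<omega>
    using pos[OF that] unfolding eq[OF that] by simp
  then have "(\<Sum>(x, y)\<in>(\<lambda>\<omega>. (X \<omega>, Y \<omega>)) ` set_pmf p. pmf (map_pmf (\<lambda>\<omega>. (X \<omega>, Y \<omega>)) p) (x, y) *
      log b (pmf (map_pmf (\<lambda>\<omega>. (X \<omega>, Y \<omega>)) p) (x, y) / pmf (map_pmf Y p) y)) = 0"
    by (intro sum.neutral) (simp add: ball_simps)
  then show ?thesis
    unfolding Cond_Ent_def
    using conditional_entropy_eq[OF simple_distributed_finite_space[OF fin, of Y]
        simple_distributed_finite_space[OF fin, of "\<lambda>\<omega>. (X \<omega>, Y \<omega>)"]]
    by (simp only: space_finite_space)
qed

lemma Ent_uniform:
  assumes fin: "finite (set_pmf p)" and b: "1 < b"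
    and unif: "map_pmf X p = pmf_of_set S" and S: "finite S" "S \<noteq> {}"
  shows "Ent b p X = log b (card S)"
proof -
  interpret information_space "finite_space p" b
    by (rule information_space_finite_space[OF fin b])
  have "X ` set_pmf p = S"
    using unif S by (metis set_map_pmf set_pmf_of_set)
  moreover have "log b (1 / card S) = - log b (card S)"
    using S b card_gt_0_iff[of S] by (subst log_divide) auto
  ultimately show ?thesis
    unfolding Ent_def
    using entropy_simple_distributed[OF simple_distributed_finite_space[OF fin, of X]] S
    by (simp add: unif)
qed

text \<open>By \<open>shift\<close> every fibre of \<open>r\<close> embeds into every other one.
  Hence all fibres have the same size, and each point of \<open>B\<close> gets the same
  mass.\<close>

lemma map_pmf_of_set_uniform:
  assumes A: "finite A" "A \<noteq> {}" and r: "r ` A = B"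
    and shift: "\<And>x y. x \<in> A \<Longrightarrow> y \<in> A \<Longrightarrow>
      \<exists>\<tau>. inj_on \<tau> {a\<in>A. r a = r x} \<and> \<tau> ` {a\<in>A. r a = r x} \<subseteq> {a\<in>A. r a = r y}"
  shows "map_pmf r (pmf_of_set A) = pmf_of_set B"
proof (rule pmf_eqI)
  fix z
  define f where "f x = card {a\<in>A. r a = x}" for x
  have B: "finite B" "B \<noteq> {}" using A r by auto
  have le: "f x \<le> f y" if xy: "x \<in> B" "y \<in> B" for x y
  proof -
    from xy obtain a c where ac: "a \<in> A" "c \<in> A" and eq: "x = r a" "y = r c"
      unfolding r[symmetric] by auto
    from shift[OF ac] obtain \<tau> where "inj_on \<tau> {a'\<in>A. r a' = x}"
      "\<tau> ` {a'\<in>A. r a' = x} \<subseteq> {a'\<in>A. r a' = y}"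
      unfolding eq by blast
    then show ?thesis
      unfolding f_def by (rule card_inj_on_le) (simp add: A)
  qed
  have total: "card A = (\<Sum>x\<in>B. f x)"
    unfolding f_def using sum.group[of A B r "\<lambda>_. 1::nat"] A B r by simp
  show "pmf (map_pmf r (pmf_of_set A)) z = pmf (pmf_of_set B) z"
  proof (cases "z \<in> B")
    case True
    then have "f x = f z" if "x \<in> B" for x using le that by (meson le_antisym)
    then have "card A = card B * f z" using total by simp
    moreover have "card A > 0" "card B > 0" using A B by auto
    ultimately have "f z / card A = 1 / card B" by (auto simp: field_simps)
    moreover have "A \<inter> r -` {z} = {a\<in>A. r a = z}" by auto
    ultimately show ?thesis
      using True A B by (simp add: pmf_map measure_pmf_of_set f_def)
  next
    case False
    then have "A \<inter> r -` {z} = {}" using r by auto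
    then show ?thesis using False A B by (simp add: pmf_map measure_pmf_of_set)
  qed
qed

section \<open>PIR schemes with queries and answers of arbitrary type\<close>

text \<open>The source of the product laws below: a variable whose law given the first component
  never changes is independent of that component.\<close>

lemma map_pmf_pair_const:
  assumes "\<And>a. a \<in> set_pmf A \<Longrightarrow> map_pmf (h a) B = D"
  shows "map_pmf (\<lambda>(a, b). (a, h a b)) (pair_pmf A B) = pair_pmf A D"
proof -
  have "map_pmf (\<lambda>(a, b). (a, h a b)) (pair_pmf A B) = bind_pmf A (\<lambda>a. map_pmf (Pair a) (map_pmf
      (h a) B))"
    by (simp add: pair_pmf_def map_bind_pmf map_pmf_def[symmetric] pmf.map_comp o_def)
  also have "\<dots> = bind_pmf A (\<lambda>a. map_pmf (Pair a) D)"
    by (intro bind_pmf_cong refl) (simp add: assms)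
  also have "\<dots> = pair_pmf A D"
    by (simp add: pair_pmf_def map_pmf_def)
  finally show ?thesis .
qed

lemma map_pmf_pair_const_snd:
  assumes "\<And>a. a \<in> set_pmf A \<Longrightarrow> map_pmf (\<lambda>b. h (a, b)) B = D"
  shows "map_pmf h (pair_pmf A B) = D"
proof -
  have "map_pmf h (pair_pmf A B) = map_pmf snd (map_pmf (\<lambda>(a, b). (a, h (a, b))) (pair_pmf A B))"
    by (simp add: pmf.map_comp o_def split_beta)
  then show ?thesis
    using map_pmf_pair_const[of A "\<lambda>a b. h (a, b)", OF assms] by (simp add: map_snd_pair_pmf)
qed

text \<open>Reduces privacy to a statement without a prior on the index: the view has the same law
  for every wanted file.\<close>

lemma Mut_Inf_index_eq_0:
  assumes fin: "finite (set_pmf d)" "finite (set_pmf P)" and b: "1 < b"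
    and D: "\<And>i. i \<in> set_pmf d \<Longrightarrow> map_pmf (X i) P = D"
  shows "Mut_Inf b (pair_pmf d P) fst (\<lambda>(i, \<omega>). X i \<omega>) = 0"
proof (rule Mut_Inf_eq_0)
  have "(\<lambda>\<omega>. (fst \<omega>, case \<omega> of (i, \<omega>) \<Rightarrow> X i \<omega>)) = (\<lambda>(i, \<omega>). (i, X i \<omega>))"
    by auto
  then show "map_pmf (\<lambda>\<omega>. (fst \<omega>, case \<omega> of (i, \<omega>) \<Rightarrow> X i \<omega>)) (pair_pmf d P) = pair_pmf d D"
    using map_pmf_pair_const[of d X, OF D] by simp
qed (use fin b in auto)

lemma finite_all_files: "finite (carrier F) \<Longrightarrow> finite (all_files F K M L)"
  unfolding all_files_def by (intro finite_PiE) auto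

text \<open>Overwriting component \<open>i\<close> carries the fibre over one value injectively into
  the fibre over another.\<close>

lemma map_pmf_all_files_component:
  assumes "finite (carrier F)" "carrier F \<noteq> {}" "i \<in> {1..M}"
  shows "map_pmf (\<lambda>W. W i) (pmf_of_set (all_files F K M L)) =
    pmf_of_set ({1..L} \<rightarrow>\<^sub>E {1..K} \<rightarrow>\<^sub>E carrier F)"
proof (rule map_pmf_of_set_uniform)
  have ne: "{1..L} \<rightarrow>\<^sub>E {1..K} \<rightarrow>\<^sub>E carrier F \<noteq> {}"
    using assms by (simp add: PiE_eq_empty_iff)
  show "finite (all_files F K M L)" by (rule finite_all_files) fact
  show "all_files F K M L \<noteq> {}" using assms by (simp add: all_files_def PiE_eq_empty_iff)
  show "(\<lambda>W. W i) ` all_files F K M L = {1..L} \<rightarrow>\<^sub>E {1..K} \<rightarrow>\<^sub>E carrier F"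
  proof (intro equalityI subsetI)
    fix z assume "z \<in> {1..L} \<rightarrow>\<^sub>E {1..K} \<rightarrow>\<^sub>E carrier F"
    then have "(\<lambda>j\<in>{1..M}. z) \<in> all_files F K M L" by (simp add: all_files_def)
    then show "z \<in> (\<lambda>W. W i) ` all_files F K M L"
      by (rule rev_image_eqI) (use assms(3) in simp)
  next
    fix z assume "z \<in> (\<lambda>W. W i) ` all_files F K M L"
    then show "z \<in> {1..L} \<rightarrow>\<^sub>E {1..K} \<rightarrow>\<^sub>E carrier F"
      unfolding all_files_def using assms(3) by (blast dest: PiE_mem)
  qed
  fix x y assume xy: "x \<in> all_files F K M L" "y \<in> all_files F K M L"
  have "inj_on (\<lambda>W. W(i := y i)) {W \<in> all_files F K M L. W i = x i}"
    by (rule inj_onI) (metis (mono_tags, lifting) fun_upd_triv fun_upd_upd mem_Collect_eq)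
  moreover have "W(i := y i) \<in> all_files F K M L" if "W \<in> all_files F K M L" for W
  proof -
    have "y i \<in> {1..L} \<rightarrow>\<^sub>E {1..K} \<rightarrow>\<^sub>E carrier F"
      using xy(2) assms(3) unfolding all_files_def by (rule PiE_mem)
    then have "W(i := y i) \<in> insert i {1..M} \<rightarrow>\<^sub>E {1..L} \<rightarrow>\<^sub>E {1..K} \<rightarrow>\<^sub>E carrier F"
      using that unfolding all_files_def by (rule PiE_fun_upd)
    then show ?thesis
      by (simp only: all_files_def insert_absorb[OF assms(3)])
  qed
  then have "(\<lambda>W. W(i := y i)) ` {W \<in> all_files F K M L. W i =
      x i} \<subseteq> {W \<in> all_files F K M L. W i = y i}"
    by auto
  ultimately show "\<exists>\<tau>. inj_on \<tau> {W \<in> all_files F K M L. W i = x i} \<and>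
      \<tau> ` {W \<in> all_files F K M L. W i = x i} \<subseteq> {W \<in> all_files F K M L. W i = y i}"
    by blast
qed

text \<open>Separates the probability theory from the algebra. The user draws \<open>P\<close>
  uniformly from \<open>\<P>\<close>, and the query is the function that the server has to apply to
  its content. For a colluding set, the queries for any \<open>i\<close> arise from one family
  \<open>q0\<close> after a permutation of the draw; a permutation preserves the uniform law, so
  neither queries nor feedbacks depend on \<open>i\<close> in law. Uniform answers turn the
  entropies of the rate into the exponents \<open>e n\<close>.\<close>

lemma pir_scheme_from_functions:
  fixes F :: "('a, 'm) ring_scheme" and \<P> :: "'p set"
    and q :: "nat \<Rightarrow> nat \<Rightarrow> 'p \<Rightarrow> (nat \<Rightarrow> nat \<Rightarrow> 'a) \<Rightarrow> 'r"
  assumes F: "finite (carrier F)" "1 < card (carrier F)"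
    and \<P>: "finite \<P>" "\<P> \<noteq> {}"
    and \<TT>: "\<TT> \<subseteq> Pow {1..N}"
    and correct: "\<And>i P W W'. \<lbrakk>i \<in> {1..M}; P \<in> \<P>; W \<in> all_files F K M L; W' \<in> all_files F K M L;
      \<And>n. n \<in> {1..N} \<Longrightarrow> q i n P (stored F K M L G W n) = q i n P (stored F K M L G W' n)\<rbrakk> \<Longrightarrow>
          W i = W' i"
    and private_queries: "\<And>T. T \<in> \<TT> \<Longrightarrow> \<exists>q0. \<forall>i\<in>{1..M}. \<exists>\<sigma>. bij_betw \<sigma> \<P> \<P> \<and>
      (\<forall>P\<in>\<P>. \<forall>n\<in>T. q i n P = q0 n (\<sigma> P))"
    and unif: "\<And>i n P. \<lbrakk>i \<in> {1..M}; n \<in> {1..N}; P \<in> \<P>\<rbrakk> \<Longrightarrow>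
      map_pmf (\<lambda>W. q i n P (stored F K M L G W n)) (pmf_of_set (all_files F K M L)) =
          pmf_of_set (R n)"
    and R: "\<And>n. n \<in> {1..N} \<Longrightarrow> finite (R n) \<and> card (R n) = card (carrier F) ^ e n"
  shows "\<exists>s :: (nat, nat, nat, nat, 'a) pir_scheme. is_pir_scheme F N K M L G \<TT> s \<and>
    (\<forall>i\<in>{1..M}. pir_rate F N K M L G s i = real (L * K) / real (\<Sum>n=1..N. e n))"
proof -
  let ?A = "all_files F K M L" and ?st = "stored F K M L G"
  \<comment> \<open>Enumerations of finite sets turn the random choices, the query functions and the
    answers into natural numbers; \<open>dP\<close> and \<open>dQ\<close> undo them.\<close>
  define eP dP where "eP = to_nat_on \<P>" and "dP = from_nat_into \<P>"
  define \<Q> where "\<Q> = (\<lambda>(i, n, P). q i n P) ` ({1..M} \<times> {1..N} \<times> \<P>)"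
  define eQ dQ where "eQ = to_nat_on \<Q>" and "dQ = from_nat_into \<Q>"
  define eR where "eR = to_nat_on (\<Union>n\<in>{1..N}. R n)"
  define U where "U = eP ` \<P>"
  define s :: "(nat, nat, nat, nat, 'a) pir_scheme" where
    "s = \<lparr>user_rand = pmf_of_set U, server_rand = return_pmf 0,
      query = (\<lambda>i n f. eQ (q i n (dP f))), feedback = (\<lambda>n x g y. eR (dQ x y))\<rparr>"
  define P where "P = pir_law F K M L s"
  have cne: "carrier F \<noteq> {}" using F by auto
  have A: "finite ?A" "?A \<noteq> {}"
    using F cne by (simp_all add: finite_all_files) (simp add: all_files_def PiE_eq_empty_iff)
  have dP: "dP (eP x) = x" if "x \<in> \<P>" for x
    using that \<P> by (simp add: dP_def eP_def countable_finite)
  have U: "finite U" "U \<noteq> {}" using \<P> by (auto simp: U_def)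
  have dPU: "dP f \<in> \<P>" "eP (dP f) = f" if "f \<in> U" for f
    using that dP by (auto simp: U_def)
  have "finite \<Q>" using \<P> by (simp add: \<Q>_def)
  moreover have "q i n x \<in> \<Q>" if "i \<in> {1..M}" "n \<in> {1..N}" "x \<in> \<P>" for i n x
    unfolding \<Q>_def by (rule rev_image_eqI[of "(i, n, x)"]) (use that in auto)
  ultimately have dQ: "dQ (eQ (q i n x)) = q i n x" if "i \<in> {1..M}" "n \<in> {1..N}" "x \<in> \<P>" for i n x
    unfolding dQ_def eQ_def using that by (intro from_nat_into_to_nat_on countable_finite)
  have "finite (\<Union>n\<in>{1..N}. R n)" using R by auto
  then have eR: "inj_on eR (\<Union>n\<in>{1..N}. R n)"
    unfolding eR_def by (intro inj_on_to_nat_on countable_finite)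
  have Rne: "R n \<noteq> {}" if "n \<in> {1..N}" for n
    using R[OF that] F by (auto simp: card_eq_0_iff)
  have qR: "q i n x (?st W n) \<in> R n" if "i \<in> {1..M}" "n \<in> {1..N}" "x \<in> \<P>" "W \<in> ?A" for i n x W
    \<comment> \<open>The values of the answer are the support of its law, which is
      \<open>R n\<close> by \<open>unif\<close>.\<close>
    using arg_cong[OF unif[OF that(1-3)], of set_pmf] A R[OF that(2)] Rne[OF that(2)] that(4)
    by auto
  have P: "P = pair_pmf (pmf_of_set U) (pair_pmf (return_pmf 0) (pmf_of_set ?A))"
    by (simp add: P_def pir_law_def s_def)
  have setP: "set_pmf P = U \<times> {0} \<times> ?A" using U A by (simp add: P)
  have finP: "finite (set_pmf P)" using U A by (simp add: setP)
  have b: "1 < real (card (carrier F))" using F by simp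
  have fb: "feedbacks F K M L G s i T (f, g, W) = (\<lambda>n\<in>T. eR (q i n (dP f) (?st W n)))"
    if "i \<in> {1..M}" "T \<subseteq> {1..N}" "f \<in> U" for i T f g W
    using that dQ dPU by (auto simp: feedbacks_def s_def fun_eq_iff)
  have queries: "queries s i T (f, g, W) = (\<lambda>n\<in>T. eQ (q i n (dP f)))" for i T f g W
    by (simp add: queries_def s_def)
  have 1: "Mut_Inf (card (carrier F)) P (queries s i {1..N}) (\<lambda>(f, g, W). W) = 0" for i
  proof (rule Mut_Inf_eq_0[OF finP b])
    let ?h = "\<lambda>f. \<lambda>n\<in>{1..N}. eQ (q i n (dP f))"
    have "map_pmf (\<lambda>\<omega>. (queries s i {1..N} \<omega>, case \<omega> of (f, g, W) \<Rightarrow> W)) P =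
        map_pmf (apfst ?h) (map_pmf (\<lambda>(f, gW). (f, snd gW)) P)"
      unfolding pmf.map_comp by (intro map_pmf_cong refl) (auto simp: queries)
    also have "map_pmf (\<lambda>(f, gW). (f, snd gW)) P = pair_pmf (pmf_of_set U) (pmf_of_set ?A)"
      unfolding P by (rule map_pmf_pair_const) (simp add: map_snd_pair_pmf)
    finally show "map_pmf (\<lambda>\<omega>. (queries s i {1..N} \<omega>, case \<omega> of (f, g, W) \<Rightarrow> W)) P =
        pair_pmf (map_pmf ?h (pmf_of_set U)) (pmf_of_set ?A)"
      by (simp only: pair_map_pmf1)
  qed
  have 2: "Cond_Ent (card (carrier F)) P (\<lambda>(f, g, W). W i) (\<lambda>(f, g, W).
      (queries s i {1..N} (f, g, W), feedbacks F K M L G s i {1..N} (f, g, W), f, g)) = 0"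
    if i: "i \<in> {1..M}" for i
  proof (rule Cond_Ent_eq_0[OF finP b])
    fix \<omega> \<omega>'
    assume \<omega>: "\<omega> \<in> set_pmf P" "\<omega>' \<in> set_pmf P"
      and eq: "(case \<omega> of (f, g, W) \<Rightarrow>
          (queries s i {1..N} (f, g, W), feedbacks F K M L G s i {1..N} (f, g, W), f, g)) =
        (case \<omega>' of (f, g, W) \<Rightarrow>
          (queries s i {1..N} (f, g, W), feedbacks F K M L G s i {1..N} (f, g, W), f, g))"
    obtain f g W where 1: "\<omega> = (f, g, W)" by (rule prod_cases3)
    obtain f' g' W' where 2: "\<omega>' = (f', g', W')" by (rule prod_cases3)
    have f: "f \<in> U" and W: "W \<in> ?A" "W' \<in> ?A"
      using \<omega> by (simp_all add: setP 1 2)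
    have f': "f' = f"
      and eq: "feedbacks F K M L G s i {1..N} (f, g, W) =
          feedbacks F K M L G s i {1..N} (f', g', W')"
      using eq unfolding 1 2 prod.case prod.inject by blast+
    have "W i = W' i"
    proof (rule correct[OF i dPU(1)[OF f] W])
      fix n assume n: "n \<in> {1..N}"
      have "eR (q i n (dP f) (?st W n)) = eR (q i n (dP f) (?st W' n))"
        using fun_cong[OF eq, of n] n unfolding f' fb[OF i subset_refl f] by simp
      then show "q i n (dP f) (?st W n) = q i n (dP f) (?st W' n)"
        by (rule inj_onD[OF eR]) (use n qR[OF i n dPU(1)[OF f]] W in blast)+
    qed
    then show "(case \<omega> of (f, g, W) \<Rightarrow> W i) = (case \<omega>' of (f, g, W) \<Rightarrow> W i)"
      by (simp add: 1 2)
  qed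
  have 3: "Mut_Inf (card (carrier F)) (pair_pmf d P) fst (\<lambda>(i, \<omega>). queries s i T \<omega>) = 0 \<and>
      Mut_Inf (card (carrier F)) (pair_pmf d P) fst (\<lambda>(i, \<omega>). feedbacks F K M L G s i T \<omega>) = 0"
    if T: "T \<in> \<TT>" and d: "set_pmf d \<subseteq> {1..M}" for T and d :: "nat pmf"
  proof -
    have TN: "T \<subseteq> {1..N}" using T \<TT> by auto
    have fin: "finite (set_pmf d)" by (rule finite_subset[OF d]) simp
    obtain q0 where q0: "\<forall>i\<in>{1..M}. \<exists>\<sigma>. bij_betw \<sigma> \<P> \<P> \<and> (\<forall>P\<in>\<P>. \<forall>n\<in>T. q i n P = q0 n (\<sigma> P))"
      using private_queries[OF T] by blast
    \<comment> \<open>The views that \<open>T\<close> would have under \<open>q0\<close>; the wanted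
      file does not occur in them.\<close>
    define XQ where "XQ = (\<lambda>(f, g :: nat, W :: 'a files). \<lambda>n\<in>T. eQ (q0 n (dP f)))"
    define XA where "XA = (\<lambda>(f, g :: nat, W). \<lambda>n\<in>T. eR (q0 n (dP f) (?st W n)))"
    have "map_pmf (queries s i T) P = map_pmf XQ P \<and> map_pmf (feedbacks F K M L G s i T) P =
        map_pmf XA P"
      if i: "i \<in> {1..M}" for i
    proof -
      obtain \<sigma> where \<sigma>: "bij_betw \<sigma> \<P> \<P>" "\<And>x n. x \<in> \<P> \<Longrightarrow> n \<in> T \<Longrightarrow> q i n x = q0 n (\<sigma> x)"
        using q0 i by blast
      \<comment> \<open>This is \<open>\<sigma>\<close> transported to the codes in
        \<open>U\<close>. It preserves the uniform law there, so applying it to the user's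
        randomness leaves \<open>P\<close> unchanged.\<close>
      define \<tau> where "\<tau> = eP \<circ> \<sigma> \<circ> dP"
      have "bij_betw dP U \<P>" "bij_betw eP \<P> U"
        by (rule bij_betwI[where g = eP]; use dP dPU in \<open>auto simp: U_def\<close>)
          (rule bij_betwI[where g = dP]; use dP dPU in \<open>auto simp: U_def\<close>)
      then have "bij_betw \<tau> U U"
        unfolding \<tau>_def using \<sigma>(1) by (intro bij_betw_trans)
      then have "map_pmf \<tau> (pmf_of_set U) = pmf_of_set U"
        using U by (intro map_pmf_of_set_bij_betw)
      then have inv: "P = map_pmf (apfst \<tau>) P"
        by (simp add: P pair_map_pmf1[symmetric])
      have d\<tau>: "dP (\<tau> f) = \<sigma> (dP f)" if "f \<in> U" for f
        using dP dPU[OF that] \<sigma>(1) by (auto simp: \<tau>_def bij_betw_def)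
      have "map_pmf XQ P = map_pmf (\<lambda>\<omega>. XQ (apfst \<tau> \<omega>)) P" "map_pmf XA P =
          map_pmf (\<lambda>\<omega>. XA (apfst \<tau> \<omega>)) P"
        by (subst inv, simp add: pmf.map_comp o_def)+
      moreover have "map_pmf (queries s i T) P = map_pmf (\<lambda>\<omega>. XQ (apfst \<tau> \<omega>)) P"
        by (intro map_pmf_cong refl) (auto simp: setP queries XQ_def d\<tau> \<sigma>(2) dPU)
      moreover have "map_pmf (feedbacks F K M L G s i T) P = map_pmf (\<lambda>\<omega>. XA (apfst \<tau> \<omega>)) P"
        by (intro map_pmf_cong refl) (auto simp: setP fb[OF i TN] XA_def d\<tau> \<sigma>(2) dPU)
      ultimately show ?thesis by simp
    qed
    then show ?thesis
      using Mut_Inf_index_eq_0[OF fin finP b, of "\<lambda>i. queries s i T" "map_pmf XQ P"]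
        Mut_Inf_index_eq_0[OF fin finP b, of "\<lambda>i. feedbacks F K M L G s i T" "map_pmf XA P"] d
            by blast
  qed
  have "is_pir_scheme F N K M L G \<TT> s"
    unfolding is_pir_scheme_def Let_def P_def[symmetric]
    using 1 2 3 U by (auto simp: s_def)
  moreover have "pir_rate F N K M L G s i = real (L * K) / real (\<Sum>n=1..N. e n)"
      if i: "i \<in> {1..M}" for i
  proof -
    let ?S = "{1..L} \<rightarrow>\<^sub>E {1..K} \<rightarrow>\<^sub>E carrier F"
    have "map_pmf (\<lambda>(f, g, W). W i) P = pmf_of_set ?S"
      unfolding P
      by (intro map_pmf_pair_const_snd) (simp add: map_pmf_all_files_component[OF F(1) cne i])
    then have "Ent (card (carrier F)) P (\<lambda>(f, g, W). W i) = log (card (carrier F)) (card ?S)"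
      by (rule Ent_uniform[OF finP b]) (use F cne in \<open>auto simp: PiE_eq_empty_iff intro!:
          finite_PiE\<close>)
    also have "card ?S = card (carrier F) ^ (L * K)"
      by (simp add: card_PiE power_mult[symmetric] mult.commute)
    finally have H: "Ent (card (carrier F)) P (\<lambda>(f, g, W). W i) = L * K"
      using b by (simp add: log_nat_power)
    have "Ent (card (carrier F)) P (\<lambda>\<omega>. feedbacks F K M L G s i {n} \<omega> n) =
        e n" if n: "n \<in> {1..N}" for n
    proof -
      have inj: "inj_on eR (R n)" using eR n by (meson UN_upper inj_on_subset)
      have "map_pmf (\<lambda>\<omega>. feedbacks F K M L G s i {n} \<omega> n) P = pmf_of_set (eR ` R n)"
        unfolding P
      proof (intro map_pmf_pair_const_snd)
        fix f g assume "f \<in> set_pmf (pmf_of_set U)"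
        then have f: "f \<in> U" using U by simp
        have "map_pmf (\<lambda>W. feedbacks F K M L G s i {n} (f, g, W) n) (pmf_of_set ?A) =
            map_pmf eR (map_pmf (\<lambda>W. q i n (dP f) (?st W n)) (pmf_of_set ?A))"
          using fb[OF i _ f, of "{n}" g] n by (simp add: pmf.map_comp o_def)
        then show "map_pmf (\<lambda>W. feedbacks F K M L G s i {n} (f, g, W) n) (pmf_of_set ?A) =
            pmf_of_set (eR ` R n)"
          using inj R[OF n] Rne[OF n] by (simp add: unif[OF i n] dPU f map_pmf_of_set_inj)
      qed
      then have "Ent (card (carrier F)) P (\<lambda>\<omega>. feedbacks F K M L G s i {n} \<omega> n) =
          log (card (carrier F)) (card (eR ` R n))"
        by (rule Ent_uniform[OF finP b]) (use R Rne n in auto)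
      also have "\<dots> = e n"
        using inj R[OF n] b by (simp add: card_image log_nat_power)
      finally show ?thesis .
    qed
    then show ?thesis
      using H by (simp add: pir_rate_def Let_def P_def[symmetric])
  qed
  ultimately show ?thesis by blast
qed

section \<open>Linear maps over a finite field\<close>

lemma (in abelian_monoid) finsum_swap:
  assumes "finite A" "finite B" "\<And>a b. a \<in> A \<Longrightarrow> b \<in> B \<Longrightarrow> f a b \<in> carrier G"
  shows "(\<Oplus>a\<in>A. \<Oplus>b\<in>B. f a b) = (\<Oplus>b\<in>B. \<Oplus>a\<in>A. f a b)"
  using assms(1,3)
proof (induction A)
  case empty
  then show ?case by simp
next
  case (insert x A)
  then have "(\<Oplus>a\<in>insert x A. \<Oplus>b\<in>B. f a b) = (\<Oplus>b\<in>B. f x b) \<oplus> (\<Oplus>b\<in>B. \<Oplus>a\<in>A. f a b)"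
    by (subst finsum_insert) auto
  also have "\<dots> = (\<Oplus>b\<in>B. f x b \<oplus> (\<Oplus>a\<in>A. f a b))"
    using insert by (intro finsum_addf[symmetric]) auto
  also have "\<dots> = (\<Oplus>b\<in>B. \<Oplus>a\<in>insert x A. f a b)"
    using insert by (intro finsum_cong') auto
  finally show ?case .
qed

lemma (in abelian_monoid) finsum_delta:
  assumes "finite A" "a \<in> A" "f \<in> A \<rightarrow> carrier G"
  shows "(\<Oplus>x\<in>A. if x = a then f x else \<zero>) = f a"
  using add.finprod_singleton_swap[of a A f] assms by simp

lemma (in domain) power_sums_eq_zero_imp:
  assumes fin: "finite (carrier R)" "finite S" and n: "card S = n"
    and \<alpha>: "inj_on \<alpha> S" "\<alpha> \<in> S \<rightarrow> carrier R" and c: "c \<in> {..<n} \<rightarrow> carrier R"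
    and zero: "\<And>v. v \<in> S \<Longrightarrow> (\<Oplus>d\<in>{..<n}. c d \<otimes> \<alpha> v [^] d) = \<zero>" and d: "d < n"
  shows "c d = \<zero>"
proof (rule ccontr)
  note neutral = add.finprod_mono_neutral_cong_left and cong = finsum_cong'
  interpret UP_domain R "UP R" by unfold_locales auto
  assume cd: "c d \<noteq> \<zero>"
  define p where "p = (\<lambda>k. if k < n then c k else \<zero>)"
  have p: "p \<in> up R"
    by (rule mem_upI) (use c in \<open>auto simp: p_def bound_def intro!: exI[of _ n]\<close>)
  then have P: "p \<in> carrier (UP R)" by (simp add: UP_def)
  have coeff: "coeff (UP R) p k = p k" for k using p by (simp add: UP_def)
  have "deg R p < n"
  proof -
    have "deg R p \<le> n - 1"
      using d by (intro deg_aboveI P) (simp_all only: coeff, auto simp: p_def)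
    then show ?thesis using d by simp
  qed
  have "p \<noteq> \<zero>\<^bsub>UP R\<^esub>"
    using coeff[of d] coeff_zero[of d] cd d by (auto simp: p_def)
  then have roots: "card {a \<in> carrier R. eval R R id a p = \<zero>} \<le> deg R p"
    using roots_bound[OF P _ fin(1)] by blast
  have "eval R R id (\<alpha> v) p = \<zero>" if v: "v \<in> S" for v
  proof -
    have \<alpha>v: "\<alpha> v \<in> carrier R" using \<alpha> v by auto
    have "eval R R id (\<alpha> v) p = (\<Oplus>k\<in>{..deg R p}. p k \<otimes> \<alpha> v [^] k)"
      using P by (simp add: eval_on_carrier coeff)
    also have "\<dots> = (\<Oplus>k\<in>{..<n}. p k \<otimes> \<alpha> v [^] k)"
    proof (rule neutral)
      fix k assume "k \<in> {..<n} - {..deg R p}"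
      then have "p k = \<zero>" using deg_aboveD[OF _ P, of k] coeff by auto
      then show "p k \<otimes> \<alpha> v [^] k = \<zero>" using \<alpha>v by simp
    qed (use \<open>deg R p < n\<close> \<alpha>v c in \<open>auto simp: p_def Pi_iff\<close>)
    also have "\<dots> = (\<Oplus>k\<in>{..<n}. c k \<otimes> \<alpha> v [^] k)"
      using c \<alpha>v by (intro cong) (auto simp: p_def)
    finally show ?thesis using zero[OF v] by simp
  qed
  then have "\<alpha> ` S \<subseteq> {a \<in> carrier R. eval R R id a p = \<zero>}" using \<alpha>(2) by auto
  then have "card (\<alpha> ` S) \<le> deg R p"
    using roots fin(1) card_mono[of "{a \<in> carrier R. eval R R id a p = \<zero>}" "\<alpha> ` S"] by simp
  then show False using \<open>deg R p < n\<close> \<alpha>(1) n by (simp add: card_image)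
qed

abbreviation (in ring) vec :: "'i set \<Rightarrow> ('i \<Rightarrow> 'a) set" where
  "vec X \<equiv> X \<rightarrow>\<^sub>E carrier R"

lemma (in ring) finsum_diff:
  assumes "finite A" "f \<in> A \<rightarrow> carrier R" "g \<in> A \<rightarrow> carrier R"
  shows "(\<Oplus>a\<in>A. f a \<ominus> g a) = (\<Oplus>a\<in>A. f a) \<ominus> (\<Oplus>a\<in>A. g a)"
  using assms(1,2,3)
proof (induction A)
  case empty
  then show ?case by (simp add: minus_eq)
next
  case (insert x A)
  then have "f x \<in> carrier R" "g x \<in> carrier R" "finsum R f A \<in> carrier R" "finsum R g A \<in>
      carrier R"
    "f \<in> A \<rightarrow> carrier R" "g \<in> A \<rightarrow> carrier R"
    by (auto intro!: finsum_closed)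
  moreover have "(\<Oplus>a\<in>insert x A. f a \<ominus> g a) = (f x \<ominus> g x) \<oplus> (\<Oplus>a\<in>A. f a \<ominus> g a)"
    using insert by (subst finsum_insert) auto
  ultimately show ?case
    using insert by (simp add: finsum_insert minus_eq minus_add a_ac)
qed

section \<open>Square linear systems over a finite commutative ring\<close>

context cring begin

text \<open>Independence of the rows makes the linear map injective, and an injection between finite
  sets of equal size is onto. Counting replaces determinants.\<close>

lemma square_system_bij:
  fixes S :: "'i set" and X :: "'j set"
  assumes R: "finite (carrier R)" and fin: "finite S" "finite X" and card: "card S = card X"
    and A: "\<And>s t. s \<in> S \<Longrightarrow> t \<in> X \<Longrightarrow> A s t \<in> carrier R"
    and indep: "\<forall>c \<in> S \<rightarrow> carrier R. (\<forall>t\<in>X. (\<Oplus>s\<in>S. c s \<otimes> A s t) = \<zero>) \<longrightarrow> (\<forall>s\<in>S. c s = \<zero>)"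
  shows "bij_betw (\<lambda>c. \<lambda>t\<in>X. \<Oplus>s\<in>S. c s \<otimes> A s t) (vec S) (vec X)"
proof -
  let ?f = "\<lambda>c. \<lambda>t\<in>X. \<Oplus>s\<in>S. c s \<otimes> A s t"
  have inj: "inj_on ?f (vec S)"
  proof (rule inj_onI)
    fix c c' assume c: "c \<in> vec S" "c' \<in> vec S" and eq: "?f c = ?f c'"
    have c_in: "c s \<in> carrier R" "c' s \<in> carrier R" if "s \<in> S" for s using c that by auto
    have "\<forall>s\<in>S. c s \<ominus> c' s = \<zero>"
    proof (rule indep[rule_format, of "\<lambda>s. c s \<ominus> c' s", THEN ballI])
      show "(\<lambda>s. c s \<ominus> c' s) \<in> S \<rightarrow> carrier R" using c_in by auto
      fix t assume t: "t \<in> X"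
      have "(\<Oplus>s\<in>S. (c s \<ominus> c' s) \<otimes> A s t) = (\<Oplus>s\<in>S. c s \<otimes> A s t \<ominus> c' s \<otimes> A s t)"
        using A t c_in by (intro finsum_cong') (auto simp: minus_eq l_distr l_minus)
      also have "\<dots> = (\<Oplus>s\<in>S. c s \<otimes> A s t) \<ominus> (\<Oplus>s\<in>S. c' s \<otimes> A s t)"
        using fin A t c_in by (intro finsum_diff) auto
      also have "(\<Oplus>s\<in>S. c s \<otimes> A s t) = (\<Oplus>s\<in>S. c' s \<otimes> A s t)"
        using fun_cong[OF eq, of t] t by simp
      finally show "(\<Oplus>s\<in>S. (c s \<ominus> c' s) \<otimes> A s t) = \<zero>"
        using A t c_in by (simp add: minus_eq r_neg finsum_closed Pi_def)
    qed
    then show "c = c'"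
      using c_in by (intro PiE_ext[OF c]) (simp add: r_right_minus_eq)
  qed
  have "?f ` vec S \<subseteq> vec X" using A by (auto intro!: finsum_closed m_closed dest: PiE_mem)
  moreover have "card (vec S) = card (vec X)" using fin card by (simp add: card_PiE)
  ultimately have "?f ` vec S = vec X"
    using R fin card_image[OF inj] by (intro card_subset_eq) (simp_all add: finite_PiE)
  with inj show ?thesis
    by (rule bij_betw_imageI)
qed

text \<open>The rows are independent, but the unknowns stand on the other side of the matrix. By
  \<open>square_system_bij\<close> some combination \<open>c\<close> of the rows is the unit vector
  at \<open>t\<close>; the same combination of the equations isolates \<open>x t\<close>.\<close>

lemma square_system_transpose:
  fixes S :: "'i set" and X :: "'j set"
  assumes R: "finite (carrier R)" and fin: "finite S" "finite X" and card: "card S = card X"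
    and A: "\<And>s t. s \<in> S \<Longrightarrow> t \<in> X \<Longrightarrow> A s t \<in> carrier R"
    and indep: "\<forall>c \<in> S \<rightarrow> carrier R. (\<forall>t\<in>X. (\<Oplus>s\<in>S. c s \<otimes> A s t) = \<zero>) \<longrightarrow> (\<forall>s\<in>S. c s = \<zero>)"
    and x: "x \<in> X \<rightarrow> carrier R" "x' \<in> X \<rightarrow> carrier R"
    and eq: "\<And>s. s \<in> S \<Longrightarrow> (\<Oplus>t\<in>X. A s t \<otimes> x t) = (\<Oplus>t\<in>X. A s t \<otimes> x' t)"
    and t: "t \<in> X"
  shows "x t = x' t"
proof -
  have "(\<lambda>u\<in>X. if u = t then \<one> else \<zero>) \<in> vec X" by auto
  then obtain c where c: "c \<in> vec S" and ct: "(\<lambda>u\<in>X. \<Oplus>s\<in>S. c s \<otimes> A s u) = (\<lambda>u\<in>X. if u =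
      t then \<one> else \<zero>)"
    using square_system_bij[of S X A, OF R fin card A indep]
        unfolding bij_betw_def by (metis (no_types, lifting) imageE)
  have c_in: "c s \<in> carrier R" if "s \<in> S" for s using c that by auto
  have "z t = (\<Oplus>s\<in>S. c s \<otimes> (\<Oplus>u\<in>X. A s u \<otimes> z u))" if z: "z \<in> X \<rightarrow> carrier R" for z
  proof -
    have zt: "z u \<in> carrier R" if "u \<in> X" for u using z that by auto
    have "(\<Oplus>s\<in>S. c s \<otimes> (\<Oplus>u\<in>X. A s u \<otimes> z u)) = (\<Oplus>s\<in>S. \<Oplus>u\<in>X. c s \<otimes> A s u \<otimes> z u)"
      using fin A c_in zt by (intro finsum_cong') (auto simp: finsum_rdistr m_assoc intro!:
          finsum_closed finsum_cong')
    also have "\<dots> = (\<Oplus>u\<in>X. \<Oplus>s\<in>S. c s \<otimes> A s u \<otimes> z u)"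
      using fin A c_in zt by (intro finsum_swap) auto
    also have "\<dots> = (\<Oplus>u\<in>X. if u = t then z u else \<zero>)"
    proof (intro finsum_cong')
      fix u assume u: "u \<in> X"
      have "(\<Oplus>s\<in>S. c s \<otimes> A s u \<otimes> z u) = (\<Oplus>s\<in>S. c s \<otimes> A s u) \<otimes> z u"
        using fin A c_in zt u by (subst finsum_ldistr) auto
      also have "(\<Oplus>s\<in>S. c s \<otimes> A s u) = (if u = t then \<one> else \<zero>)"
        using fun_cong[OF ct, of u] u by simp
      finally show "(\<Oplus>s\<in>S. c s \<otimes> A s u \<otimes> z u) = (if u = t then z u else \<zero>)"
        using zt[OF u] by (cases "u = t") simp_all
    qed (use zt in auto)
    also have "\<dots> = z t" using fin t z by (intro finsum_delta)
    finally show ?thesis ..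
  qed
  note this[OF x(1)] this[OF x(2)]
  moreover have "(\<Oplus>s\<in>S. c s \<otimes> (\<Oplus>u\<in>X. A s u \<otimes> x u)) = (\<Oplus>s\<in>S. c s \<otimes> (\<Oplus>u\<in>X. A s u \<otimes> x' u))"
    using c_in x A by (intro finsum_cong') (auto simp: eq intro!: finsum_closed m_closed)
  ultimately show ?thesis by simp
qed

section \<open>Linear maps and isomorphisms between coordinate spaces\<close>

definition lin_map :: "'i set \<Rightarrow> 'j set \<Rightarrow> (('i \<Rightarrow> 'a) \<Rightarrow> 'j \<Rightarrow> 'a) \<Rightarrow> bool" where
  "lin_map X Y P \<longleftrightarrow> P \<in> vec X \<rightarrow>\<^sub>E vec Y \<and>
    (\<forall>x\<in>vec X. \<forall>y\<in>vec X. \<forall>c\<in>carrier R.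
      P (\<lambda>t\<in>X. x t \<oplus> c \<otimes> y t) = (\<lambda>t\<in>Y. P x t \<oplus> c \<otimes> P y t))"

lemma lin_map_in: "lin_map X Y P \<Longrightarrow> x \<in> vec X \<Longrightarrow> P x \<in> vec Y"
  unfolding lin_map_def by auto

lemma lin_map_in_carrier: "lin_map X Y P \<Longrightarrow> x \<in> vec X \<Longrightarrow> t \<in> Y \<Longrightarrow> P x t \<in> carrier R"
  by (rule PiE_mem[OF lin_map_in])

lemma lin_map_add:
  "lin_map X Y P \<Longrightarrow> x \<in> vec X \<Longrightarrow> y \<in> vec X \<Longrightarrow> c \<in> carrier R \<Longrightarrow>
    P (\<lambda>t\<in>X. x t \<oplus> c \<otimes> y t) = (\<lambda>t\<in>Y. P x t \<oplus> c \<otimes> P y t)"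
  unfolding lin_map_def by blast

lemma lin_map_zero:
  assumes P: "lin_map X Y P"
  shows "P (\<lambda>t\<in>X. \<zero>) = (\<lambda>t\<in>Y. \<zero>)"
proof -
  let ?z = "\<lambda>t\<in>X. \<zero>"
  have z: "?z \<in> vec X" by auto
  \<comment> \<open>The zero vector is written as \<open>z - z\<close>, so that its image becomes
    \<open>P z - P z\<close>.\<close>
  have "P ?z = P (\<lambda>t\<in>X. ?z t \<oplus> (\<ominus> \<one>) \<otimes> ?z t)"
    by (rule arg_cong[of _ _ P]) auto
  also have "\<dots> = (\<lambda>t\<in>Y. P ?z t \<oplus> (\<ominus> \<one>) \<otimes> P ?z t)"
    by (rule lin_map_add[OF P z z]) simp
  also have "\<dots> = (\<lambda>t\<in>Y. \<zero>)"
    using lin_map_in_carrier[OF P z] by (auto simp: l_minus r_neg)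
  finally show ?thesis .
qed

text \<open>The scalars stand on the right as in \<open>stored\<close>, where they are the entries
  \<open>G k n\<close>; this lets linear queries pass through the storage code.\<close>

lemma lin_map_sum:
  assumes P: "lin_map X Y P" and "finite S"
    and "\<And>k. k \<in> S \<Longrightarrow> c k \<in> carrier R" "\<And>k. k \<in> S \<Longrightarrow> x k \<in> vec X"
  shows "P (\<lambda>t\<in>X. \<Oplus>k\<in>S. x k t \<otimes> c k) = (\<lambda>t\<in>Y. \<Oplus>k\<in>S. P (x k) t \<otimes> c k)"
  using assms(2-)
proof (induction S)
  case empty
  then show ?case using lin_map_zero[OF P] by (simp only: finsum_empty)
next
  case (insert s S)
  let ?y = "\<lambda>t\<in>X. \<Oplus>k\<in>S. x k t \<otimes> c k"
  have x: "x k t \<in> carrier R" if "k \<in> insert s S" "t \<in> X" for k t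
    using insert.prems(2)[OF that(1)] that(2) by auto
  have Px: "P (x k) t \<in> carrier R" if "k \<in> insert s S" "t \<in> Y" for k t
    using lin_map_in_carrier[OF P insert.prems(2)[OF that(1)] that(2)] .
  have c: "c k \<in> carrier R" if "k \<in> insert s S" for k using insert.prems(1)[OF that] .
  have y: "?y \<in> vec X" using x c by (auto intro!: finsum_closed)
  have "(\<lambda>t\<in>X. \<Oplus>k\<in>insert s S. x k t \<otimes> c k) = (\<lambda>t\<in>X. ?y t \<oplus> c s \<otimes> x s t)"
  proof (rule restrict_ext)
    fix t assume t: "t \<in> X"
    then show "(\<Oplus>k\<in>insert s S. x k t \<otimes> c k) = ?y t \<oplus> c s \<otimes> x s t"
      using insert.hyps x c by (subst finsum_insert) (auto simp: m_comm a_comm intro!: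
          finsum_closed)
  qed
  then have "P (\<lambda>t\<in>X. \<Oplus>k\<in>insert s S. x k t \<otimes> c k) = (\<lambda>t\<in>Y. P ?y t \<oplus> c s \<otimes> P (x s) t)"
    using lin_map_add[OF P y insert.prems(2)[of s] c[of s]] by simp
  also have "P ?y = (\<lambda>t\<in>Y. \<Oplus>k\<in>S. P (x k) t \<otimes> c k)"
    using insert.prems by (intro insert.IH) auto
  also have "(\<lambda>t\<in>Y. (\<lambda>t\<in>Y. \<Oplus>k\<in>S. P (x k) t \<otimes> c k) t \<oplus> c s \<otimes> P (x s) t) =
      (\<lambda>t\<in>Y. \<Oplus>k\<in>insert s S. P (x k) t \<otimes> c k)"
  proof (rule restrict_ext)
    fix t assume t: "t \<in> Y"
    have "(\<Oplus>k\<in>insert s S. P (x k) t \<otimes> c k) = P (x s) t \<otimes> c s \<oplus> (\<Oplus>k\<in>S. P (x k) t \<otimes> c k)"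
      using insert.hyps Px c t by (intro finsum_insert) auto
    also have "\<dots> = (\<Oplus>k\<in>S. P (x k) t \<otimes> c k) \<oplus> c s \<otimes> P (x s) t"
      using Px[of s t] c t by (subst m_comm) (auto intro!: a_comm finsum_closed Px)
    finally show "(\<lambda>t\<in>Y. \<Oplus>k\<in>S. P (x k) t \<otimes> c k) t \<oplus> c s \<otimes> P (x s) t =
        (\<Oplus>k\<in>insert s S. P (x k) t \<otimes> c k)"
      using t by (simp only: restrict_apply if_True)
  qed
  finally show ?case .
qed

lemma lin_map_compose:
  assumes P: "lin_map X Y P" and Q: "lin_map Y Z Q"
  shows "lin_map X Z (compose (vec X) Q P)"
  unfolding lin_map_def
proof (intro conjI ballI)
  show "compose (vec X) Q P \<in> vec X \<rightarrow>\<^sub>E vec Z"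
    using lin_map_in[OF P] lin_map_in[OF Q] by (auto simp: compose_def)
  fix x y c assume x: "x \<in> vec X" and y: "y \<in> vec X" and c: "c \<in> carrier R"
  have "(\<lambda>t\<in>X. x t \<oplus> c \<otimes> y t) \<in> vec X" using x y c by auto
  then show "compose (vec X) Q P (\<lambda>t\<in>X. x t \<oplus> c \<otimes> y t) =
      (\<lambda>t\<in>Z. compose (vec X) Q P x t \<oplus> c \<otimes> compose (vec X) Q P y t)"
    using lin_map_add[OF P x y c] lin_map_add[OF Q lin_map_in[OF P x] lin_map_in[OF P y] c] x y
    by (simp only: compose_eq)
qed

text \<open>The sample space for the random bijection applied to one file. Extensionality in
  \<open>lin_map\<close> makes it finite and makes maps equal that agree on
  \<open>vec X\<close>.\<close>

definition lin_iso :: "'i set \<Rightarrow> 'j set \<Rightarrow> (('i \<Rightarrow> 'a) \<Rightarrow> 'j \<Rightarrow> 'a) set" where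
  "lin_iso X Y = {P. lin_map X Y P \<and> bij_betw P (vec X) (vec Y)}"

lemma finite_lin_iso:
  assumes "finite (carrier R)" "finite X" "finite Y"
  shows "finite (lin_iso X Y)"
proof (rule finite_subset)
  show "lin_iso X Y \<subseteq> vec X \<rightarrow>\<^sub>E vec Y" by (auto simp: lin_iso_def lin_map_def)
qed (simp add: assms finite_PiE)

text \<open>Relabelling the coordinates along a bijection of the index sets is an
  isomorphism.\<close>

lemma lin_iso_nonempty:
  assumes "finite X" "finite Y" "card X = card Y"
  shows "lin_iso X Y \<noteq> {}"
proof -
  obtain \<beta> where \<beta>: "bij_betw \<beta> Y X" using finite_same_card_bij assms by metis
  define P where "P = (\<lambda>x\<in>vec X. \<lambda>t\<in>Y. x (\<beta> t))"
  have \<beta>X: "\<beta> t \<in> X" if "t \<in> Y" for t using \<beta> that by (auto simp: bij_betw_def)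
  have "lin_map X Y P"
    unfolding lin_map_def
  proof (intro conjI ballI)
    show "P \<in> vec X \<rightarrow>\<^sub>E vec Y" using \<beta>X by (auto simp: P_def)
    fix x y c assume x: "x \<in> vec X" and y: "y \<in> vec X" and c: "c \<in> carrier R"
    have "(\<lambda>t\<in>X. x t \<oplus> c \<otimes> y t) \<in> vec X" using x y c by auto
    then show "P (\<lambda>t\<in>X. x t \<oplus> c \<otimes> y t) = (\<lambda>t\<in>Y. P x t \<oplus> c \<otimes> P y t)"
      using x y \<beta>X by (auto simp: P_def fun_eq_iff)
  qed
  moreover have "bij_betw P (vec X) (vec Y)"
  proof (rule bij_betwI[where g = "\<lambda>y. \<lambda>s\<in>X. y (inv_into Y \<beta> s)"])
    have inv: "inv_into Y \<beta> s \<in> Y" "\<beta> (inv_into Y \<beta> s) = s" if "s \<in> X" for s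
      using \<beta> that by (auto simp: bij_betw_def inv_into_into f_inv_into_f)
    show "P \<in> vec X \<rightarrow> vec Y" using \<beta>X by (auto simp: P_def)
    show "(\<lambda>y. \<lambda>s\<in>X. y (inv_into Y \<beta> s)) \<in> vec Y \<rightarrow> vec X" using inv by auto
    show "(\<lambda>s\<in>X. P x (inv_into Y \<beta> s)) = x" if "x \<in> vec X" for x
      using that inv by (intro ext) (auto simp: P_def PiE_def extensional_def)
    show "P (\<lambda>s\<in>X. y (inv_into Y \<beta> s)) = y" if "y \<in> vec Y" for y
    proof -
      have "(\<lambda>s\<in>X. y (inv_into Y \<beta> s)) \<in> vec X" using that inv by auto
      then show ?thesis
        using that \<beta> \<beta>X by (intro ext) (auto simp: P_def bij_betw_def PiE_def extensional_def)
    qed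
  qed
  ultimately show ?thesis by (auto simp: lin_iso_def)
qed

lemma lin_iso_endoI:
  assumes "finite (carrier R)" "finite X" "lin_map X X P" "inj_on P (vec X)"
  shows "P \<in> lin_iso X X"
proof -
  have "P ` vec X \<subseteq> vec X" using lin_map_in[OF assms(3)] by blast
  then have "P ` vec X = vec X"
    using endo_inj_surj[of "vec X" P] assms by (simp add: finite_PiE)
  then show ?thesis using assms by (simp add: lin_iso_def bij_betw_def)
qed

lemma lin_iso_compose:
  assumes "P \<in> lin_iso X Y" "Q \<in> lin_iso Y Z"
  shows "compose (vec X) Q P \<in> lin_iso X Z"
proof -
  have "bij_betw (Q \<circ> P) (vec X) (vec Z)"
    using assms by (auto simp: lin_iso_def intro: bij_betw_trans)
  then have "bij_betw (compose (vec X) Q P) (vec X) (vec Z)"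
    by (subst bij_betw_cong[where g = "Q \<circ> P"]) (auto simp: compose_def)
  then show ?thesis using assms lin_map_compose by (auto simp: lin_iso_def)
qed

text \<open>Cancellation of \<open>Q\<close>. With \<open>Q\<close> taken to be \<open>adj\<close>,
  it makes composition a permutation of the user's random choices.\<close>

lemma lin_iso_compose_inj:
  assumes P: "P \<in> lin_iso X Y" "P' \<in> lin_iso X Y" and Q: "Q \<in> lin_iso Y Z"
    and eq: "compose (vec X) Q P = compose (vec X) Q P'"
  shows "P = P'"
proof (rule PiE_ext)
  show PX: "P \<in> vec X \<rightarrow>\<^sub>E vec Y" "P' \<in> vec X \<rightarrow>\<^sub>E vec Y" using P
      by (auto simp: lin_iso_def lin_map_def)
  fix x assume x: "x \<in> vec X"
  then have "Q (P x) = Q (P' x)" using fun_cong[OF eq, of x] by (simp add: compose_eq)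
  moreover have "inj_on Q (vec Y)" using Q by (auto simp: lin_iso_def bij_betw_def)
  ultimately show "P x = P' x"
    using PiE_mem[OF PX(1) x] PiE_mem[OF PX(2) x] by (simp add: inj_on_eq_iff)
qed

end

section \<open>The scheme on the blocks\<close>

text \<open>
  \<open>tau b x y\<close> is \<open>- (x + y)\<close> modulo \<open>b\<close>, a totally symmetric Latin square: at virtual server
      \<open>v\<close>, the
  letter \<open>x\<close> at the position of the wanted file selects the codeword with index \<open>tau b v x\<close>.
\<close>

definition tau :: "nat \<Rightarrow> nat \<Rightarrow> nat \<Rightarrow> nat" where
  "tau b x y = (if x + y = 0 then 0 else if x + y \<le> b then b - (x + y) else 2 * b - (x + y))"

lemma tau_less: "x < b \<Longrightarrow> y < b \<Longrightarrow> tau b x y < b"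
  by (auto simp: tau_def)

lemma tau_tau: "x < b \<Longrightarrow> y < b \<Longrightarrow> tau b x (tau b x y) = y"
  by (auto simp: tau_def)

lemma tau_commute: "tau b x y = tau b y x"
  by (simp add: tau_def add.commute)

text \<open>For fixed \<open>m\<close> the map is an involution, so \<open>D\<close> values have
  \<open>D\<close> preimages. With \<open>m\<close> the letter of a codeword's index at the position
  of the wanted file, the \<open>v\<close> counted are the virtual servers asked for that codeword
  without the wanted file.\<close>

lemma card_tau_less:
  assumes "m < b" "D \<le> b"
  shows "card {v. v < b \<and> tau b v m < D} = D"
proof -
  have "{v. v < b \<and> tau b v m < D} = tau b m ` {..<D}"
  proof (intro equalityI subsetI)
    fix v assume v: "v \<in> {v. v < b \<and> tau b v m < D}"
    then have "v = tau b m (tau b v m)"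
      using assms tau_tau[of m b v] by (simp add: tau_commute)
    then show "v \<in> tau b m ` {..<D}" using v by blast
  next
    fix v assume "v \<in> tau b m ` {..<D}"
    then show "v \<in> {v. v < b \<and> tau b v m < D}"
      using assms by (auto simp: tau_less tau_tau tau_commute[of b _ m])
  qed
  moreover have "inj_on (tau b m) {..<D}"
    by (rule inj_on_inverseI[where g = "tau b m"]) (use assms in \<open>auto simp: tau_tau\<close>)
  ultimately show ?thesis by (simp add: card_image)
qed

lemma (in cring) lin_mapI:
  assumes "\<And>Z t. Z \<in> vec X \<Longrightarrow> t \<in> Y \<Longrightarrow> f Z t \<in> carrier R"
    and "\<And>x y c t. x \<in> vec X \<Longrightarrow> y \<in> vec X \<Longrightarrow> c \<in> carrier R \<Longrightarrow> t \<in> Y \<Longrightarrow>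
      f (\<lambda>s\<in>X. x s \<oplus> c \<otimes> y s) t = f x t \<oplus> c \<otimes> f y t"
  shows "lin_map X Y (\<lambda>Z\<in>vec X. \<lambda>t\<in>Y. f Z t)"
  unfolding lin_map_def
proof (intro conjI ballI)
  show "(\<lambda>Z\<in>vec X. \<lambda>t\<in>Y. f Z t) \<in> vec X \<rightarrow>\<^sub>E vec Y" using assms(1) by simp
  fix x y c assume xy: "x \<in> vec X" "y \<in> vec X" "c \<in> carrier R"
  then have "(\<lambda>s\<in>X. x s \<oplus> c \<otimes> y s) \<in> vec X" by auto
  then show "(\<lambda>Z\<in>vec X. \<lambda>t\<in>Y. f Z t) (\<lambda>s\<in>X. x s \<oplus> c \<otimes> y s) =
      (\<lambda>t\<in>Y. (\<lambda>Z\<in>vec X. \<lambda>t\<in>Y. f Z t) x t \<oplus> c \<otimes> (\<lambda>Z\<in>vec X. \<lambda>t\<in>Y. f Z t) y t)"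
    using xy assms(2)[OF xy] by (simp cong: restrict_cong)
qed

type_synonym slot = "nat \<times> (nat \<Rightarrow> nat)"

text \<open>\<open>D\<close> is the bound on the blocks met by a colluding set, and
  \<open>blk v\<close> is the block behind virtual server \<open>v\<close>. \<open>E\<close>
  generates the code used for the unwanted files, with row \<open>v\<close> giving coordinate
  \<open>v\<close>; by \<open>E_mds\<close> any \<open>D\<close> coordinates determine the
  codeword.\<close>

locale block_scheme = field R for R (structure) +
  fixes N K M b D :: nat and G :: "nat \<Rightarrow> nat \<Rightarrow> 'a" and blk :: "nat \<Rightarrow> nat set"
    and E :: "nat \<Rightarrow> nat \<Rightarrow> 'a"
  assumes finite_carrier: "finite (carrier R)"
    and K_pos: "1 \<le> K" and M_pos: "1 \<le> M" and K_le: "K \<le> N" and D_less: "D < b"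
    and mds: "mds_matrix R N K G"
    and blk: "v < b \<Longrightarrow> blk v \<subseteq> {1..N} \<and> card (blk v) = K"
    and E_in: "v < b \<Longrightarrow> d < D \<Longrightarrow> E v d \<in> carrier R"
    and E_mds: "S \<subseteq> {..<b} \<Longrightarrow> card S = D \<Longrightarrow> \<forall>c\<in>{..<D} \<rightarrow> carrier R.
      (\<forall>v\<in>S. (\<Oplus>d\<in>{..<D}. c d \<otimes> E v d) = \<zero>) \<longrightarrow> (\<forall>d\<in>{..<D}. c d = \<zero>)"
begin

section \<open>Words, index sets of file rows, and codewords\<close>

definition words :: "(nat \<Rightarrow> nat) set" where
  "words = {1..M} \<rightarrow>\<^sub>E {..<b}"

definition supp :: "(nat \<Rightarrow> nat) \<Rightarrow> nat set" where
  "supp w = {j\<in>{1..M}. D \<le> w j}"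

definition idx :: "nat \<Rightarrow> (slot) set" where
  "idx j = {..<b} \<times> {w\<in>words. D \<le> w j}"

definition pos :: "(nat \<Rightarrow> nat) set" where
  "pos = {w\<in>words. supp w \<noteq> {}}"

text \<open>For fixed \<open>i\<close> and \<open>v\<close> an involution on words:
  \<open>upd i v w\<close> is the index of the codeword that virtual server \<open>v\<close> uses at
  the word \<open>w\<close>, and \<open>upd i v u\<close> is the word at which \<open>v\<close> uses
  the codeword \<open>u\<close>.\<close>

definition upd :: "nat \<Rightarrow> nat \<Rightarrow> (nat \<Rightarrow> nat) \<Rightarrow> nat \<Rightarrow> nat" where
  "upd i v w = w(i := tau b v (w i))"

text \<open>Coordinate \<open>v\<close> of the codeword with index \<open>upd i v w\<close>. Its
  \<open>D\<close> information symbols are the entries of \<open>Z\<close> at this index whose first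
  component is below \<open>D\<close>.\<close>

definition code :: "nat \<Rightarrow> (slot \<Rightarrow> 'a) \<Rightarrow> nat \<Rightarrow> (nat \<Rightarrow> nat) \<Rightarrow> 'a" where
  "code i Z v w = (\<Oplus>d\<in>{..<D}. Z (d, upd i v w) \<otimes> E v d)"

lemma finite_words [simp]: "finite words"
  by (simp add: words_def finite_PiE)

lemma finite_idx [simp]: "finite (idx j)"
  by (simp add: idx_def)

lemma finite_supp [simp]: "finite (supp w)"
  by (simp add: supp_def)

lemma finite_pos [simp]: "finite pos"
  by (simp add: pos_def)

lemma words_less: "w \<in> words \<Longrightarrow> j \<in> {1..M} \<Longrightarrow> w j < b"
  by (auto simp: words_def)

lemma supp_in: "j \<in> supp w \<Longrightarrow> j \<in> {1..M}"
  by (simp add: supp_def)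

lemma supp_idx: "v < b \<Longrightarrow> w \<in> words \<Longrightarrow> j \<in> supp w \<Longrightarrow> (v, w) \<in> idx j"
  by (simp add: supp_def idx_def)

lemma upd_words: "v < b \<Longrightarrow> i \<in> {1..M} \<Longrightarrow> w \<in> words \<Longrightarrow> upd i v w \<in> words"
  using words_less[of w i] tau_less[of v b "w i"]
  by (auto simp: words_def upd_def PiE_def extensional_def)

lemma upd_upd: "v < b \<Longrightarrow> i \<in> {1..M} \<Longrightarrow> w \<in> words \<Longrightarrow> upd i v (upd i v w) = w"
  using words_less[of w i] by (simp add: upd_def tau_tau)

lemma supp_upd: "supp (upd i v w) - {i} = supp w - {i}"
  by (auto simp: supp_def upd_def)

lemma upd_idx:
  assumes "v < b" "d < b" "i \<in> {1..M}" "i \<noteq> j" "(v', w) \<in> idx j"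
  shows "(d, upd i v w) \<in> idx j"
  using assms upd_words[of v i w] by (simp add: idx_def) (simp add: upd_def)

lemma code_in:
  assumes "v < b" "i \<in> {1..M}" "i \<noteq> j" "(v', w) \<in> idx j" "Z \<in> vec (idx j)"
  shows "code i Z v w \<in> carrier R"
  unfolding code_def
proof (intro finsum_closed funcsetI m_closed)
  fix d assume "d \<in> {..<D}"
  then show "Z (d, upd i v w) \<in> carrier R" "E v d \<in> carrier R"
    using assms D_less E_in PiE_mem[OF assms(5)] upd_idx[OF assms(1) _ assms(2-4), of d] by auto
qed

lemma code_add:
  assumes v: "v < b" "i \<in> {1..M}" "i \<noteq> j" "(v', w) \<in> idx j"
    and xy: "x \<in> vec (idx j)" "y \<in> vec (idx j)" and c: "c \<in> carrier R"
  shows "code i (\<lambda>s\<in>idx j. x s \<oplus> c \<otimes> y s) v w = code i x v w \<oplus> c \<otimes> code i y v w"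
proof -
  have id: "(d, upd i v w) \<in> idx j" if "d \<in> {..<D}" for d
    using upd_idx[OF v(1) _ v(2-4), of d] that D_less by simp
  have x: "x (d, upd i v w) \<in> carrier R" and y: "y (d, upd i v w) \<in> carrier R"
      and e: "E v d \<in> carrier R"
    if "d \<in> {..<D}" for d
    using PiE_mem[OF xy(1) id[OF that]] PiE_mem[OF xy(2) id[OF that]] E_in[OF v(1)] that by auto
  have "code i (\<lambda>s\<in>idx j. x s \<oplus> c \<otimes> y s) v w =
      (\<Oplus>d\<in>{..<D}. x (d, upd i v w) \<otimes> E v d \<oplus> c \<otimes> (y (d, upd i v w) \<otimes> E v d))"
    unfolding code_def using x y e c id
    by (intro finsum_cong') (auto simp: l_distr m_assoc simp del: restrict_apply intro!:
        arg_cong2[where f = "(\<oplus>)"] simp: restrict_apply')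
  also have "\<dots> = code i x v w \<oplus> (\<Oplus>d\<in>{..<D}. c \<otimes> (y (d, upd i v w) \<otimes> E v d))"
    unfolding code_def using x y e c by (intro finsum_addf) auto
  also have "(\<Oplus>d\<in>{..<D}. c \<otimes> (y (d, upd i v w) \<otimes> E v d)) = c \<otimes> code i y v w"
    unfolding code_def using y e c by (intro finsum_rdistr[symmetric]) auto
  finally show ?thesis .
qed

text \<open>What a query does to file \<open>j\<close> after the random bijection: nothing to the
  wanted file, encoding of an unwanted one. For \<open>i \<noteq> j\<close> the entries with first
  component at least \<open>D\<close> are forgotten, so this is not a bijection and needs the
  completion \<open>adj\<close>.\<close>

definition coded :: "nat \<Rightarrow> nat \<Rightarrow> (slot \<Rightarrow> 'a) \<Rightarrow> slot \<Rightarrow> 'a" where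
  "coded i j = (\<lambda>Z\<in>vec (idx j). \<lambda>t\<in>idx j. if i = j then Z t else code i Z (fst t) (snd t))"

lemma lin_map_coded:
  assumes i: "i \<in> {1..M}"
  shows "lin_map (idx j) (idx j) (coded i j)"
  unfolding coded_def
proof (rule lin_mapI)
  fix Z t assume "Z \<in> vec (idx j)" "t \<in> idx j"
  then show "(if i = j then Z t else code i Z (fst t) (snd t)) \<in> carrier R"
    using code_in[of "fst t" i j "fst t" "snd t" Z] i by (auto simp: idx_def)
next
  fix x y c t assume *: "x \<in> vec (idx j)" "y \<in> vec (idx j)" "c \<in> carrier R" "t \<in> idx j"
  then show "(if i = j then (\<lambda>s\<in>idx j. x s \<oplus> c \<otimes> y s) t else code i (\<lambda>s\<in>idx j. x s \<oplus> c \<otimes> y s)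
      (fst t) (snd t)) =
      (if i = j then x t else code i x (fst t) (snd t)) \<oplus> c \<otimes> (if i =
          j then y t else code i y (fst t) (snd t))"
    using code_add[of "fst t" i j "fst t" "snd t" x y c] i by (auto simp: idx_def)
qed

text \<open>
  \<open>adj S \<pi> i j\<close> agrees with \<open>coded i j\<close> on the virtual servers in \<open>S\<close>
      and is completed to a bijection
  outside \<open>S\<close>; composing the random bijection with it turns the queries for file \<open>i\<close> seen in \<open>S\<close>
  into queries that do not depend on \<open>i\<close>.
\<close>

definition adj :: "nat set \<Rightarrow> (nat \<Rightarrow> nat) \<Rightarrow> nat \<Rightarrow> nat \<Rightarrow> (slot \<Rightarrow> 'a) \<Rightarrow> slot \<Rightarrow> 'a" where
  "adj S \<pi> i j = (\<lambda>Z\<in>vec (idx j). \<lambda>t\<in>idx j. if i = j then Z t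
     else if fst t \<in> S then code i Z (fst t) (snd t) else Z (\<pi> (fst t), upd i (fst t) (snd t)))"

text \<open>Any \<open>D\<close> coordinates form an information set. Injectivity
  (\<open>code_eqD\<close>) serves decoding, surjectivity (\<open>code_surj\<close>) serves
  prescribing answers.\<close>

lemma code_bij:
  assumes S: "S \<subseteq> {..<b}" "card S = D"
  shows "bij_betw (\<lambda>c. \<lambda>v\<in>S. \<Oplus>d\<in>{..<D}. c d \<otimes> E v d) (vec {..<D}) (vec S)"
proof -
  have "finite S" using S finite_subset by blast
  then show ?thesis
    using finite_carrier S E_in E_mds[OF S] by (intro square_system_bij) auto
qed

lemma code_eqD:
  assumes S: "S \<subseteq> {..<b}" "card S = D" and x: "x \<in> {..<D} \<rightarrow> carrier R" "x' \<in> {..<D} \<rightarrow> carrier R"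
    and eq: "\<And>v. v \<in> S \<Longrightarrow> (\<Oplus>d\<in>{..<D}. x d \<otimes> E v d) = (\<Oplus>d\<in>{..<D}. x' d \<otimes> E v d)"
    and d: "d < D"
  shows "x d = x' d"
proof -
  let ?f = "\<lambda>c. \<lambda>v\<in>S. \<Oplus>d\<in>{..<D}. c d \<otimes> E v d"
  have inj: "inj_on ?f (vec {..<D})" using code_bij[OF S] by (simp add: bij_betw_def)
  have "?f (restrict x {..<D}) = ?f (restrict x' {..<D})"
  proof (rule restrict_ext)
    fix v assume v: "v \<in> S"
    have "(\<Oplus>d\<in>{..<D}. restrict z {..<D} d \<otimes> E v d) = (\<Oplus>d\<in>{..<D}. z d \<otimes> E v d)"
      if "z \<in> {..<D} \<rightarrow> carrier R" for z
      using that subsetD[OF S(1) v] E_in[of v] by (intro finsum_cong') auto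
    then show "(\<Oplus>d\<in>{..<D}. restrict x {..<D} d \<otimes> E v d) = (\<Oplus>d\<in>{..<D}. restrict x' {..<D} d \<otimes> E v d)"
      using x eq[OF v] by simp
  qed
  then have "restrict x {..<D} = restrict x' {..<D}"
    by (rule inj_onD[OF inj _ restrict_PiE_iff[THEN iffD2] restrict_PiE_iff[THEN iffD2]])
      (use x in \<open>simp_all add: Pi_iff\<close>)
  then show ?thesis using d by (metis lessThan_iff restrict_apply')
qed

lemma code_surj:
  assumes S: "S \<subseteq> {..<b}" "card S = D" and y: "y \<in> S \<rightarrow> carrier R"
  obtains x where "x \<in> vec {..<D}" "\<And>v. v \<in> S \<Longrightarrow> (\<Oplus>d\<in>{..<D}. x d \<otimes> E v d) = y v"
proof -
  have "restrict y S \<in> vec S" using y by auto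
  then obtain x where x: "x \<in> vec {..<D}" "restrict y S = (\<lambda>v\<in>S. \<Oplus>d\<in>{..<D}. x d \<otimes> E v d)"
    using code_bij[OF S] unfolding bij_betw_def by (metis (no_types, lifting) imageE)
  have "(\<Oplus>d\<in>{..<D}. x d \<otimes> E v d) = y v" if "v \<in> S" for v
    by (rule fun_cong[OF x(2), of v, unfolded restrict_apply'[OF that], symmetric])
  with x(1) show ?thesis by (rule that)
qed

text \<open>By finiteness injectivity suffices. The entry \<open>(d, u)\<close> can be read off from
  the image at words \<open>upd i v u\<close>: for \<open>D \<le> d\<close> at the one server
  \<open>v\<close> outside \<open>S\<close> with \<open>\<pi> v = d\<close>; for
  \<open>d < D\<close> from the coordinates of the codeword \<open>u\<close> at the \<open>D\<close>
  servers in \<open>S\<close>.\<close>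

lemma adj_lin_iso:
  assumes S: "S \<subseteq> {..<b}" "card S = D" and \<pi>: "bij_betw \<pi> ({..<b} - S) {D..<b}"
    and i: "i \<in> {1..M}"
  shows "adj S \<pi> i j \<in> lin_iso (idx j) (idx j)"
proof (rule lin_iso_endoI)
  have \<pi>_less: "\<pi> v < b" if "v < b" "v \<notin> S" for v
    using \<pi> that by (auto simp: bij_betw_def)
  show "lin_map (idx j) (idx j) (adj S \<pi> i j)"
    unfolding adj_def
  proof (rule lin_mapI)
    fix Z t assume *: "Z \<in> vec (idx j)" "t \<in> idx j"
    obtain v w where t: "t = (v, w)" by (cases t)
    have v: "v < b" using * by (simp add: t idx_def)
    show "(if i = j then Z t else if fst t \<in> S then code i Z (fst t) (snd t)
        else Z (\<pi> (fst t), upd i (fst t) (snd t))) \<in> carrier R"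
      using * v i code_in[of v i j v w Z] upd_idx[of v "\<pi> v" i j v w] \<pi>_less
      by (auto simp: t intro: PiE_mem)
  next
    fix x y c t assume *: "x \<in> vec (idx j)" "y \<in> vec (idx j)" "c \<in> carrier R" "t \<in> idx j"
    obtain v w where t: "t = (v, w)" by (cases t)
    have v: "v < b" using * by (simp add: t idx_def)
    let ?f = "\<lambda>Z. if i = j then Z t else if fst t \<in> S then code i Z (fst t) (snd t)
        else Z (\<pi> (fst t), upd i (fst t) (snd t))"
    show "?f (\<lambda>s\<in>idx j. x s \<oplus> c \<otimes> y s) = ?f x \<oplus> c \<otimes> ?f y"
      using * v i code_add[of v i j v w x y c] upd_idx[of v "\<pi> v" i j v w] \<pi>_less
      by (auto simp: t)
  qed
  show "inj_on (adj S \<pi> i j) (vec (idx j))"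
  proof (rule inj_onI)
    fix Z Z' assume Z: "Z \<in> vec (idx j)" "Z' \<in> vec (idx j)" and eq: "adj S \<pi> i j Z = adj S \<pi> i j Z'"
    have at: "(if i = j then Z (v, w) else if v \<in> S then code i Z v w else Z (\<pi> v, upd i v w)) =
        (if i = j then Z' (v, w) else if v \<in> S then code i Z' v w else Z' (\<pi> v, upd i v w))"
      if "(v, w) \<in> idx j" for v w
      using fun_cong[OF eq, of "(v, w)"] that Z
      by (simp only: adj_def restrict_apply if_True fst_conv snd_conv)
    show "Z = Z'"
    proof (rule PiE_ext[OF Z])
      fix t assume t: "t \<in> idx j"
      obtain d u where du: "t = (d, u)" by (cases t)
      then have d: "d < b" and u: "u \<in> words" "D \<le> u j" using t by (auto simp: idx_def)
      consider "i = j" | "i \<noteq> j" "D \<le> d" | "i \<noteq> j" "d < D" by linarith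
      then show "Z t = Z' t"
      proof cases
        case 1
        then show ?thesis using at[of d u] t du by simp
      next
        case 2
        then have "d \<in> \<pi> ` ({..<b} - S)" using \<pi> d by (simp add: bij_betw_def)
        then obtain v where v: "v < b" "v \<notin> S" "\<pi> v = d" by auto
        have "(v, upd i v u) \<in> idx j" using upd_idx[of v v i j d u] v i 2 t du by simp
        then show ?thesis using at[of v "upd i v u"] 2 v i u by (simp add: upd_upd du)
      next
        case 3
        have id: "(d', u) \<in> idx j" if "d' < D" for d' using that u D_less by (simp add: idx_def)
        have "Z (d, u) = Z' (d, u)"
        proof (rule code_eqD[OF S, where x = "\<lambda>d. Z (d, u)" and x' = "\<lambda>d. Z' (d, u)"])
          show "(\<lambda>d. Z (d, u)) \<in> {..<D} \<rightarrow> carrier R" "(\<lambda>d. Z' (d, u)) \<in> {..<D} \<rightarrow> carrier R"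
            using PiE_mem[OF Z(1) id] PiE_mem[OF Z(2) id] by auto
          fix v assume v: "v \<in> S"
          then have vb: "v < b" using S by auto
          have "(v, upd i v u) \<in> idx j" using upd_idx[of v v i j d u] vb i 3 t du by simp
          then have "code i Z v (upd i v u) = code i Z' v (upd i v u)"
            using at[of v "upd i v u"] 3 v by simp
          then show "(\<Oplus>d\<in>{..<D}. Z (d, u) \<otimes> E v d) = (\<Oplus>d\<in>{..<D}. Z' (d, u) \<otimes> E v d)"
            using vb i u by (simp add: code_def upd_upd)
        qed (use 3 in simp)
        then show ?thesis by (simp add: du)
      qed
    qed
  qed
qed (simp_all add: finite_carrier)

section \<open>Decoding and prescribing the answers of the virtual servers\<close>

lemma coded_in:
  assumes "i \<in> {1..M}" "v < b" "w \<in> words" "j \<in> supp w" "Z \<in> vec (idx j)"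
  shows "coded i j Z (v, w) \<in> carrier R"
  by (rule lin_map_in_carrier[OF lin_map_coded[OF assms(1)] assms(5) supp_idx[OF assms(2-4)]])

text \<open>The code is linear, and at a given server and word all unwanted files use the same
  codeword index and the same coordinate. Their sum is thus a coordinate of a single codeword, whose
  information symbols are the sums.\<close>

lemma coded_interference:
  assumes i: "i \<in> {1..M}" and v: "v < b" and w: "w \<in> words" and S: "S \<subseteq> supp w - {i}"
    and Z: "\<And>j. j \<in> S \<Longrightarrow> Z j \<in> vec (idx j)"
  shows "(\<Oplus>j\<in>S. coded i j (Z j) (v, w)) = (\<Oplus>d\<in>{..<D}. (\<Oplus>j\<in>S. Z j (d, upd i v w)) \<otimes> E v d)"
proof -
  have fin: "finite S" by (rule finite_subset[OF S]) simp
  have ij: "i \<noteq> j" "(v, w) \<in> idx j" if "j \<in> S" for j using that S v w supp_idx by auto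
  have z: "Z j (d, upd i v w) \<in> carrier R" if "j \<in> S" "d < D" for j d
    using PiE_mem[OF Z upd_idx[OF v _ i ij]] that D_less by auto
  have "(\<Oplus>j\<in>S. coded i j (Z j) (v, w)) = (\<Oplus>j\<in>S. \<Oplus>d\<in>{..<D}. Z j (d, upd i v w) \<otimes> E v d)"
  proof (intro finsum_cong')
    fix j assume j: "j \<in> S"
    then show "coded i j (Z j) (v, w) = (\<Oplus>d\<in>{..<D}. Z j (d, upd i v w) \<otimes> E v d)"
      using ij Z by (simp add: coded_def code_def)
  qed (use z E_in v in \<open>auto intro!: finsum_closed\<close>)
  also have "\<dots> = (\<Oplus>d\<in>{..<D}. \<Oplus>j\<in>S. Z j (d, upd i v w) \<otimes> E v d)"
    using fin z E_in v by (intro finsum_swap) auto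
  also have "\<dots> = (\<Oplus>d\<in>{..<D}. (\<Oplus>j\<in>S. Z j (d, upd i v w)) \<otimes> E v d)"
    using fin z E_in v by (intro finsum_cong') (auto simp: finsum_ldistr intro!: finsum_closed)
  finally show ?thesis .
qed

text \<open>The interference at \<open>(v, w)\<close> is coordinate \<open>v\<close> of the summed
  codeword with index \<open>u = upd i v w\<close>. Unless it is empty, \<open>D\<close> virtual
  servers are asked for this codeword without file \<open>i\<close>. These coordinates fix it, so
  the interference can be cancelled and the entry of the wanted file remains.\<close>

lemma decode:
  assumes i: "i \<in> {1..M}"
    and Z: "\<And>j. j \<in> {1..M} \<Longrightarrow> Z j \<in> vec (idx j)" "\<And>j. j \<in> {1..M} \<Longrightarrow> Z' j \<in> vec (idx j)"
    and eq: "\<And>v w. v < b \<Longrightarrow> w \<in> pos \<Longrightarrow>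
      (\<Oplus>j\<in>supp w. coded i j (Z j) (v, w)) = (\<Oplus>j\<in>supp w. coded i j (Z' j) (v, w))"
  shows "Z i = Z' i"
proof (rule PiE_ext[OF Z(1)[OF i] Z(2)[OF i]])
  fix t assume t: "t \<in> idx i"
  obtain v w where vw: "t = (v, w)" by (cases t)
  have v: "v < b" and w: "w \<in> words" and iw: "i \<in> supp w"
    using t i by (auto simp: vw idx_def supp_def)
  define S where "S = supp w - {i}"
  define u where "u = upd i v w"
  have u: "u \<in> words" "supp u - {i} = S"
    using upd_words[OF v i w] supp_upd[of i v w] by (simp_all add: u_def S_def)
  have SM: "S \<subseteq> {1..M}" by (auto simp: S_def supp_def)
  have fin: "finite S" by (simp add: S_def)
  have I_eq: "(\<Oplus>j\<in>S. coded i j (Z j) (v, w)) = (\<Oplus>j\<in>S. coded i j (Z' j) (v, w))"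
  \<comment> \<open>For empty \<open>S\<close> there is no interference. Otherwise the words
    \<open>w'\<close> below have the nonempty support \<open>S\<close>, so they do occur in
    queries.\<close>
  proof (cases "S = {}")
    case False
    define X where "X = (\<lambda>Y :: nat \<Rightarrow> slot \<Rightarrow> 'a. \<lambda>d. \<Oplus>j\<in>S. Y j (d, u))"
    have uj: "(d, u) \<in> idx j" if "d < D" "j \<in> S" for d j
      using u that D_less supp_idx[of d u j] by auto
    have X_in: "X Y \<in> {..<D} \<rightarrow> carrier R" if Y: "\<And>j. j \<in> {1..M} \<Longrightarrow> Y j \<in> vec (idx j)" for Y
      unfolding X_def using PiE_mem[OF Y uj] SM by (auto intro!: finsum_closed)
    have "X Z d = X Z' d" if d: "d < D" for d
    proof (rule code_eqD[OF _ _ X_in[OF Z(1)] X_in[OF Z(2)] _ d])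
      \<comment> \<open>The servers whose word for the codeword \<open>u\<close> has a letter below
        \<open>D\<close> at position \<open>i\<close>, that is, does not involve file
        \<open>i\<close>.\<close>
      let ?T = "{v'. v' < b \<and> tau b v' (u i) < D}"
      show "?T \<subseteq> {..<b}" by auto
      show "card ?T = D" using words_less[OF u(1) i] D_less by (intro card_tau_less) auto
      fix v' assume "v' \<in> ?T"
      then have v': "v' < b" "tau b v' (u i) < D" by auto
      define w' where "w' = upd i v' u"
      have w': "w' \<in> words" "upd i v' w' = u"
        using upd_words[OF v'(1) i u(1)] upd_upd[OF v'(1) i u(1)] by (simp_all add: w'_def)
      have "i \<notin> supp w'" using v' by (simp add: w'_def upd_def supp_def)
      then have sw': "supp w' = S" using supp_upd[of i v' u] u(2) by (simp add: w'_def)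
      then have "w' \<in> pos" using w' False by (simp add: pos_def)
      then have "(\<Oplus>j\<in>S. coded i j (Z j) (v', w')) = (\<Oplus>j\<in>S. coded i j (Z' j) (v', w'))"
        using eq[OF v'(1)] sw' by metis
      moreover have "(\<Oplus>j\<in>S. coded i j (Y j) (v', w')) = (\<Oplus>d\<in>{..<D}. X Y d \<otimes> E v' d)"
        if Y: "\<And>j. j \<in> {1..M} \<Longrightarrow> Y j \<in> vec (idx j)" for Y
      proof -
        have "S \<subseteq> supp w' - {i}" unfolding sw' by (auto simp: S_def)
        then show ?thesis
          using coded_interference[OF i v'(1) w'(1) _ Y[OF subsetD[OF SM]]]
              unfolding X_def w'(2) by blast
      qed
      ultimately show "(\<Oplus>d\<in>{..<D}. X Z d \<otimes> E v' d) = (\<Oplus>d\<in>{..<D}. X Z' d \<otimes> E v' d)"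
        using Z by simp
    qed
    moreover have "(\<Oplus>j\<in>S. coded i j (Y j) (v, w)) = (\<Oplus>d\<in>{..<D}. X Y d \<otimes> E v d)"
      if Y: "\<And>j. j \<in> {1..M} \<Longrightarrow> Y j \<in> vec (idx j)" for Y
      unfolding X_def u_def
      using coded_interference[OF i v w _ Y[OF subsetD[OF SM]]] unfolding S_def by blast
    moreover have "(\<Oplus>d\<in>{..<D}. X Z d \<otimes> E v d) = (\<Oplus>d\<in>{..<D}. X Z' d \<otimes> E v d)"
      using X_in[OF Z(2)] E_in[OF v] calculation(1) by (intro finsum_cong') auto
    ultimately show ?thesis using Z by simp
  qed simp
  have split: "(\<Oplus>j\<in>supp w. coded i j (Y j) (v, w)) = Y i (v, w) \<oplus> (\<Oplus>j\<in>S. coded i j (Y j) (v, w))"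
    and cl: "Y i (v, w) \<in> carrier R" "(\<Oplus>j\<in>S. coded i j (Y j) (v, w)) \<in> carrier R"
    if Y: "\<And>j. j \<in> {1..M} \<Longrightarrow> Y j \<in> vec (idx j)" for Y
  proof -
    have c: "coded i j (Y j) (v, w) \<in> carrier R" if "j \<in> supp w" for j
      using coded_in[OF i v w that Y[OF supp_in[OF that]]] .
    have "coded i i (Y i) (v, w) = Y i (v, w)" using Y[OF i] t by (simp add: coded_def vw)
    moreover have "supp w = insert i S" using iw by (auto simp: S_def)
    moreover have "(\<Oplus>j\<in>insert i S. coded i j (Y j) (v, w)) =
        coded i i (Y i) (v, w) \<oplus> (\<Oplus>j\<in>S. coded i j (Y j) (v, w))"
      using fin c iw by (intro finsum_insert) (auto simp: S_def)
    ultimately show "(\<Oplus>j\<in>supp w. coded i j (Y j) (v, w)) =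
        Y i (v, w) \<oplus> (\<Oplus>j\<in>S. coded i j (Y j) (v, w))"
      by simp
    show "Y i (v, w) \<in> carrier R" using PiE_mem[OF Y[OF i] t] by (simp add: vw)
    show "(\<Oplus>j\<in>S. coded i j (Y j) (v, w)) \<in> carrier R"
      using c by (intro finsum_closed) (auto simp: S_def)
  qed
  have "w \<in> pos" using w iw by (auto simp: pos_def)
  from eq[OF v this] show "Z i t = Z' i t"
    using split[of Z] split[of Z'] cl[of Z] cl[of Z'] I_eq Z by (simp add: vw)
qed

text \<open>Independence of the queried combinations, in the form that arbitrary answers can be
  prescribed. The unwanted files are chosen to match the answers without file \<open>i\<close>;
  every answer with file \<open>i\<close> then contains an entry of \<open>Z i\<close> of its own,
  which absorbs the rest.\<close>

lemma encode:
  assumes i: "i \<in> {1..M}"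
    and r: "\<And>v w. v < b \<Longrightarrow> w \<in> pos \<Longrightarrow> r (v, w) \<in> carrier R"
  obtains Z where "\<And>j. j \<in> {1..M} \<Longrightarrow> Z j \<in> vec (idx j)"
    and "\<And>v w. v < b \<Longrightarrow> w \<in> pos \<Longrightarrow> (\<Oplus>j\<in>supp w. coded i j (Z j) (v, w)) = r (v, w)"
proof -
  define T where "T u = {v. v < b \<and> tau b v (u i) < D}" for u
  \<comment> \<open>At the \<open>D\<close> servers in \<open>T u\<close> the codeword
    \<open>u\<close> is asked for without file \<open>i\<close>; its information symbols interpolate
    the prescribed answers there.\<close>
  have "\<exists>x. x \<in> vec {..<D} \<and> (\<forall>v\<in>T u. (\<Oplus>d\<in>{..<D}. x d \<otimes> E v d) = r (v, upd i v u))"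
    if u: "u \<in> words" "supp u - {i} \<noteq> {}" for u
  proof -
    have "T u \<subseteq> {..<b}" by (auto simp: T_def)
    moreover have "card (T u) = D"
      unfolding T_def using words_less[OF u(1) i] D_less by (intro card_tau_less) auto
    moreover have "upd i v u \<in> pos" if "v < b" for v
      using upd_words[OF that i u(1)] u(2) supp_upd[of i v u] by (auto simp: pos_def)
    then have "(\<lambda>v. r (v, upd i v u)) \<in> T u \<rightarrow> carrier R" using r by (auto simp: T_def)
    ultimately show ?thesis by (rule code_surj) blast
  qed
  then obtain \<zeta> where \<zeta>: "\<And>u. u \<in> words \<Longrightarrow> supp u - {i} \<noteq> {} \<Longrightarrow> \<zeta> u \<in> vec {..<D}"
    "\<And>u v. u \<in> words \<Longrightarrow> supp u - {i} \<noteq> {} \<Longrightarrow> v \<in> T u \<Longrightarrow>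
      (\<Oplus>d\<in>{..<D}. \<zeta> u d \<otimes> E v d) = r (v, upd i v u)"
    by metis
  \<comment> \<open>Only the sum over the unwanted files matters. The file of least index in the
    support carries the whole codeword and the others contribute zero; entries with first component
    at least \<open>D\<close> are set to zero as well.\<close>
  define Y where "Y j = (\<lambda>t\<in>idx j. if fst t < D \<and> j = Min (supp (snd t) - {i}) then \<zeta> (snd t)
      (fst t) else \<zero>)" for j
  have Y: "Y j \<in> vec (idx j)" if j: "j \<in> {1..M}" "j \<noteq> i" for j
  proof -
    have "\<zeta> u d \<in> carrier R" if "(d, u) \<in> idx j" "d < D" for d u
    proof -
      have "j \<in> supp u - {i}" using that j by (simp add: idx_def supp_def)
      then show ?thesis using \<zeta>(1)[of u] that by (auto simp: idx_def)
    qed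
    then show ?thesis by (auto simp: Y_def)
  qed
  \<comment> \<open>The wanted file gets the prescribed answer minus the interference; each of its
    entries occurs in one answer only.\<close>
  define Z where "Z j = (if j = i then \<lambda>t\<in>idx i. r t \<ominus> (\<Oplus>j\<in>supp (snd t) - {i}. coded i j
      (Y j) t) else Y j)" for j
  have cY: "coded i j (Y j) (v, w) \<in> carrier R" if "v < b" "w \<in> words" "j \<in> supp w - {i}" for j v w
    using that Y[of j] supp_in[of j w] coded_in[OF i, of v w j "Y j"] by simp
  have I_in: "(\<Oplus>j\<in>supp w - {i}. coded i j (Y j) (v, w)) \<in> carrier R" if "v < b" "w \<in> words" for v w
    using cY that by (intro finsum_closed) auto
  have idx_pos: "w \<in> pos" if "(v, w) \<in> idx i" for v w
    using that i by (auto simp: idx_def pos_def supp_def)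
  have Zi: "Z i \<in> vec (idx i)"
    using r I_in idx_pos by (auto simp: Z_def idx_def)
  show ?thesis
  proof (rule that)
    show "Z j \<in> vec (idx j)" if "j \<in> {1..M}" for j
      using that Y Zi by (cases "j = i") (auto simp: Z_def)
    fix v w assume v: "v < b" and w: "w \<in> pos"
    then have ww: "w \<in> words" by (simp add: pos_def)
    have rest: "(\<Oplus>j\<in>supp w - {i}. coded i j (Z j) (v, w)) =
        (\<Oplus>j\<in>supp w - {i}. coded i j (Y j) (v, w))"
      using cY[OF v ww] by (intro finsum_cong') (auto simp: Z_def)
    show "(\<Oplus>j\<in>supp w. coded i j (Z j) (v, w)) = r (v, w)"
    proof (cases "i \<in> supp w")
      case True
      then have t: "(v, w) \<in> idx i" using supp_idx v ww by blast
      have c: "coded i i (Z i) (v, w) = Z i (v, w)" using Zi t by (simp add: coded_def)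
      have Zt: "Z i (v, w) = r (v, w) \<ominus> (\<Oplus>j\<in>supp w - {i}. coded i j (Y j) (v, w))"
        using t by (simp add: Z_def)
      have "(\<Oplus>j\<in>insert i (supp w - {i}). coded i j (Z j) (v, w)) =
          coded i i (Z i) (v, w) \<oplus> (\<Oplus>j\<in>supp w - {i}. coded i j (Z j) (v, w))"
        using cY[OF v ww] PiE_mem[OF Zi t] c by (intro finsum_insert) (auto simp: Z_def)
      moreover have "insert i (supp w - {i}) = supp w" using True by auto
      ultimately show ?thesis
        unfolding rest c Zt using r[OF v w] I_in[OF v ww] by (simp add: minus_eq a_assoc l_neg)
    next
      case False
      then have sw: "supp w - {i} = supp w" by auto
      define u where "u = upd i v w"
      have u: "u \<in> words" "supp u - {i} = supp w" "upd i v u = w"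
        using upd_words[OF v i ww] supp_upd[of i v w] sw upd_upd[OF v i ww] by (simp_all add: u_def)
      have ne: "supp w \<noteq> {}" using w by (simp add: pos_def)
      define j0 where "j0 = Min (supp w)"
      have j0: "j0 \<in> supp w" using ne by (simp add: j0_def)
      \<comment> \<open>As file \<open>i\<close> is absent, \<open>v\<close> is among the servers at
        which \<open>\<zeta> u\<close> interpolates.\<close>
      have "w i < D" using False i by (simp add: supp_def)
      then have "tau b v (u i) < D"
        by (simp add: u_def upd_def tau_tau[OF v words_less[OF ww i]])
      then have "v \<in> T u" using v by (simp add: T_def)
      then have \<zeta>u: "(\<Oplus>d\<in>{..<D}. \<zeta> u d \<otimes> E v d) = r (v, w)" "\<zeta> u \<in> vec {..<D}"
        using \<zeta>[of u] u ne by auto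
      have Yd: "(\<Oplus>j\<in>supp w. Y j (d, u)) = \<zeta> u d" if d: "d < D" for d
      proof -
        have id: "(d, u) \<in> idx j" if "j \<in> supp w" for j
          using that d D_less u supp_idx[of d u j] by auto
        have "(\<Oplus>j\<in>supp w. Y j (d, u)) = (\<Oplus>j\<in>supp w. if j = j0 then \<zeta> u d else \<zero>)"
          using PiE_mem[OF \<zeta>u(2)] d id by (intro finsum_cong') (auto simp: Y_def u(2) j0_def)
        also have "\<dots> = \<zeta> u d"
          using PiE_mem[OF \<zeta>u(2)] d j0 by (intro finsum_delta) auto
        finally show ?thesis .
      qed
      have "(\<Oplus>j\<in>supp w. coded i j (Y j) (v, w)) = (\<Oplus>d\<in>{..<D}. (\<Oplus>j\<in>supp w. Y j (d, u)) \<otimes> E v d)"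
        unfolding u_def
        using Y supp_in False by (intro coded_interference[OF i v ww]) (auto simp: sw)
      also have "\<dots> = (\<Oplus>d\<in>{..<D}. \<zeta> u d \<otimes> E v d)"
        using Yd PiE_mem[OF \<zeta>u(2)] E_in[OF v] by (intro finsum_cong') auto
      finally show ?thesis using rest sw \<zeta>u by simp
    qed
  qed
qed

section \<open>Counting words and rows\<close>

lemma card_words: "card words = b ^ M"
  by (simp add: words_def card_PiE)

lemma card_idx:
  assumes j: "j \<in> {1..M}"
  shows "card (idx j) = b * ((b - D) * b ^ (M - 1))"
proof -
  have "{w\<in>words. D \<le> w j} = (\<Pi>\<^sub>E k\<in>{1..M}. if k = j then {D..<b} else {..<b})"
    using j by (auto simp: words_def PiE_iff extensional_def split: if_splits)
  then have "card {w\<in>words. D \<le> w j} = (\<Prod>k\<in>{1..M}. card (if k = j then {D..<b} else {..<b}))"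
    by (simp only: card_PiE finite_atLeastAtMost)
  also have "\<dots> = card {D..<b} * (\<Prod>k\<in>{1..M} - {j}. card (if k = j then {D..<b} else {..<b}))"
    using j by (subst prod.remove[of _ j]) auto
  also have "(\<Prod>k\<in>{1..M} - {j}. card (if k = j then {D..<b} else {..<b})) = (\<Prod>k\<in>{1..M} - {j}. b)"
    by (intro prod.cong) auto
  finally show ?thesis using j by (simp add: idx_def card_cartesian_product)
qed

lemma card_pos: "card pos = b ^ M - D ^ M"
proof -
  have "pos = words - ({1..M} \<rightarrow>\<^sub>E {..<D})"
  proof (intro equalityI subsetI)
    fix w assume "w \<in> pos"
    then obtain j where j: "j \<in> {1..M}" "\<not> w j < D" and "w \<in> words"
      by (auto simp: pos_def supp_def not_less)
    then show "w \<in> words - ({1..M} \<rightarrow>\<^sub>E {..<D})" by (blast dest: PiE_mem)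
  next
    fix w assume w: "w \<in> words - ({1..M} \<rightarrow>\<^sub>E {..<D})"
    then have "\<exists>j\<in>{1..M}. \<not> w j < D" by (auto simp: words_def PiE_iff)
    then show "w \<in> pos" using w by (auto simp: pos_def supp_def not_less)
  qed
  moreover have "({1..M} \<rightarrow>\<^sub>E {..<D}) \<subseteq> words"
    unfolding words_def using D_less by (intro PiE_mono) auto
  ultimately show ?thesis
    by (simp add: card_Diff_subset finite_PiE card_words card_PiE)
qed

text \<open>The common size of all \<open>idx j\<close>, so that the random bijections exist. Since
  \<open>1 \<le> M\<close>, it is \<open>(b - D) * b ^ M\<close>.\<close>

definition L :: nat where
  "L = b * ((b - D) * b ^ (M - 1))"

section \<open>Queries to the real servers and their answers\<close>

definition contents :: "(nat \<Rightarrow> nat \<Rightarrow> 'a) set" where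
  "contents = {1..M} \<rightarrow>\<^sub>E vec {1..L}"

text \<open>Blocks may overlap: a server answers on behalf of every block that contains it.\<close>

definition slots :: "nat \<Rightarrow> (slot) set" where
  "slots n = {v. v < b \<and> n \<in> blk v} \<times> pos"

definition answer :: "(nat \<Rightarrow> (nat \<Rightarrow> 'a) \<Rightarrow> slot \<Rightarrow> 'a) \<Rightarrow> (nat \<Rightarrow> nat \<Rightarrow> 'a) \<Rightarrow> slot \<Rightarrow> 'a" where
  "answer \<Psi> y t = (\<Oplus>j\<in>supp (snd t). \<Psi> j (y j) t)"

text \<open>The query sent to a server is the function of its content that it has to evaluate.\<close>

definition server_query :: "nat \<Rightarrow> (nat \<Rightarrow> (nat \<Rightarrow> 'a) \<Rightarrow> slot \<Rightarrow> 'a) \<Rightarrow>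
    (nat \<Rightarrow> nat \<Rightarrow> 'a) \<Rightarrow> slot \<Rightarrow> 'a" where
  "server_query n \<Psi> = (\<lambda>y\<in>contents. \<lambda>t\<in>slots n. answer \<Psi> y t)"

text \<open>The storage code combines the columns of a file, so the \<open>k\<close>-th columns of
  all files together form its \<open>k\<close>-th information symbol.\<close>

definition column :: "'a files \<Rightarrow> nat \<Rightarrow> nat \<Rightarrow> nat \<Rightarrow> 'a" where
  "column W k = (\<lambda>j\<in>{1..M}. \<lambda>l\<in>{1..L}. W j l k)"

abbreviation "all_W \<equiv> all_files R K M L"
abbreviation "store \<equiv> stored R K M L G"

lemma files_in: "W \<in> all_W \<Longrightarrow> j \<in> {1..M} \<Longrightarrow> l \<in> {1..L} \<Longrightarrow> k \<in> {1..K} \<Longrightarrow> W j l k \<in> carrier R"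
  unfolding all_files_def by (blast dest: PiE_mem)

lemma column_in: "W \<in> all_W \<Longrightarrow> j \<in> {1..M} \<Longrightarrow> k \<in> {1..K} \<Longrightarrow> column W k j \<in> vec {1..L}"
  using files_in by (simp add: column_def)

lemma G_in: "n \<in> {1..N} \<Longrightarrow> k \<in> {1..K} \<Longrightarrow> G k n \<in> carrier R"
  using mds unfolding mds_matrix_def by blast

lemma stored_eq:
  assumes "j \<in> {1..M}"
  shows "store W n j = (\<lambda>l\<in>{1..L}. \<Oplus>k\<in>{1..K}. column W k j l \<otimes> G k n)"
  using assms by (simp add: stored_def column_def cong: restrict_cong)

lemma stored_in_vec:
  assumes "W \<in> all_W" "n \<in> {1..N}" "j \<in> {1..M}"
  shows "store W n j \<in> vec {1..L}"
  unfolding stored_def using assms files_in G_in by (auto intro!: finsum_closed m_closed)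

lemma stored_contents:
  assumes "W \<in> all_W" "n \<in> {1..N}"
  shows "store W n \<in> contents"
proof -
  have "store W n = (\<lambda>j\<in>{1..M}. store W n j)" by (rule ext) (simp add: stored_def)
  moreover have "(\<lambda>j\<in>{1..M}. store W n j) \<in> contents"
    unfolding contents_def restrict_PiE_iff using stored_in_vec[OF assms] by blast
  ultimately show ?thesis by simp
qed

lemma answer_in:
  assumes \<Psi>: "\<And>j. j \<in> {1..M} \<Longrightarrow> lin_map {1..L} (idx j) (\<Psi> j)"
    and t: "t \<in> {..<b} \<times> pos" and y: "\<And>j. j \<in> {1..M} \<Longrightarrow> y j \<in> vec {1..L}"
  shows "answer \<Psi> y t \<in> carrier R"
  unfolding answer_def
proof (intro finsum_closed funcsetI)
  fix j assume j: "j \<in> supp (snd t)"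
  then have "t \<in> idx j" using t supp_idx[of "fst t" "snd t" j] by (auto simp: pos_def)
  then show "\<Psi> j (y j) t \<in> carrier R"
    using lin_map_in_carrier[OF \<Psi> y] supp_in[OF j] by blast
qed

text \<open>A linear query commutes with the storage code: the answer of server \<open>n\<close> is
  the combination, with coefficients \<open>G k n\<close>, of the answers that the \<open>K\<close>
  columns would give.\<close>

lemma answer_stored:
  assumes \<Psi>: "\<And>j. j \<in> {1..M} \<Longrightarrow> lin_map {1..L} (idx j) (\<Psi> j)"
    and t: "t \<in> {..<b} \<times> pos" and W: "W \<in> all_W" and n: "n \<in> {1..N}"
  shows "answer \<Psi> (store W n) t = (\<Oplus>k\<in>{1..K}. G k n \<otimes> answer \<Psi> (column W k) t)"
proof -
  have tj: "t \<in> idx j" if "j \<in> supp (snd t)" for j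
    using t supp_idx[of "fst t" "snd t" j] that by (auto simp: pos_def)
  have c: "\<Psi> j (column W k j) t \<in> carrier R" if "j \<in> supp (snd t)" "k \<in> {1..K}" for j k
    using lin_map_in_carrier[OF \<Psi> column_in[OF W] tj] supp_in that by blast
  note g = G_in[OF n]
  have "\<Psi> j (store W n j) t = (\<Oplus>k\<in>{1..K}. G k n \<otimes> \<Psi> j (column W k j) t)"
    if j: "j \<in> supp (snd t)" for j
  proof -
    have "\<Psi> j (store W n j) = (\<lambda>t\<in>idx j. \<Oplus>k\<in>{1..K}. \<Psi> j (column W k j) t \<otimes> G k n)"
      unfolding stored_eq[OF supp_in[OF j]]
      by (rule lin_map_sum[OF \<Psi>[OF supp_in[OF j]]]) (use g column_in[OF W supp_in[OF j]] in auto)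
    then have "\<Psi> j (store W n j) t = (\<Oplus>k\<in>{1..K}. \<Psi> j (column W k j) t \<otimes> G k n)"
      using tj[OF j] by simp
    also have "\<dots> = (\<Oplus>k\<in>{1..K}. G k n \<otimes> \<Psi> j (column W k j) t)"
      using c[OF j] g by (intro finsum_cong') (auto simp: m_comm)
    finally show ?thesis .
  qed
  note eq = this
  have "answer \<Psi> (store W n) t = (\<Oplus>j\<in>supp (snd t). \<Oplus>k\<in>{1..K}. G k n \<otimes> \<Psi> j (column W k j) t)"
    unfolding answer_def
  proof (intro finsum_cong' refl funcsetI)
    fix j assume j: "j \<in> supp (snd t)"
    show "\<Psi> j (store W n j) t = (\<Oplus>k\<in>{1..K}. G k n \<otimes> \<Psi> j (column W k j) t)" by (rule eq[OF j])
    show "(\<Oplus>k\<in>{1..K}. G k n \<otimes> \<Psi> j (column W k j) t) \<in> carrier R"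
      using c[OF j] g by (intro finsum_closed funcsetI m_closed)
  qed
  also have "\<dots> = (\<Oplus>k\<in>{1..K}. \<Oplus>j\<in>supp (snd t). G k n \<otimes> \<Psi> j (column W k j) t)"
    using c g by (intro finsum_swap) auto
  also have "\<dots> = (\<Oplus>k\<in>{1..K}. G k n \<otimes> answer \<Psi> (column W k) t)"
    unfolding answer_def using c g
    by (intro finsum_cong') (auto simp: finsum_rdistr Pi_iff intro!: finsum_closed m_closed)
  finally show ?thesis .
qed

text \<open>All \<open>K\<close> servers of \<open>blk v\<close> answer the slot
  \<open>(v, w)\<close>. By the MDS property their answers are independent combinations of the
  \<open>K\<close> answers on the columns, which can therefore be recovered: the block acts as one
  server storing all columns.\<close>

lemma columns_determined:
  assumes \<Psi>: "\<And>j. j \<in> {1..M} \<Longrightarrow> lin_map {1..L} (idx j) (\<Psi> j)"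
    and W: "W \<in> all_W" "W' \<in> all_W"
    and eq: "\<And>n. n \<in> {1..N} \<Longrightarrow> server_query n \<Psi> (store W n) = server_query n \<Psi> (store W' n)"
    and v: "v < b" and w: "w \<in> pos" and k: "k \<in> {1..K}"
  shows "answer \<Psi> (column W k) (v, w) = answer \<Psi> (column W' k) (v, w)"
proof (rule square_system_transpose[OF finite_carrier, of "blk v" "{1..K}" "\<lambda>n k. G k n"
    "\<lambda>k. answer \<Psi> (column W k) (v, w)" "\<lambda>k. answer \<Psi> (column W' k) (v, w)"])
  have t: "(v, w) \<in> {..<b} \<times> pos" using v w by simp
  show "finite (blk v)" using blk[OF v] finite_subset by blast
  show "card (blk v) = card {1..K}" using blk[OF v] by simp
  show "G k n \<in> carrier R" if "n \<in> blk v" "k \<in> {1..K}" for n k using G_in blk[OF v] that by blast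
  show "\<forall>c\<in>blk v \<rightarrow> carrier R. (\<forall>k\<in>{1..K}. (\<Oplus>n\<in>blk v. c n \<otimes> G k n) = \<zero>) \<longrightarrow> (\<forall>n\<in>blk v. c n = \<zero>)"
    using mds blk[OF v] unfolding mds_matrix_def by blast
  show "(\<lambda>k. answer \<Psi> (column W k) (v, w)) \<in> {1..K} \<rightarrow> carrier R"
    "(\<lambda>k. answer \<Psi> (column W' k) (v, w)) \<in> {1..K} \<rightarrow> carrier R"
    using answer_in[OF \<Psi> t column_in[OF W(1)]] answer_in[OF \<Psi> t column_in[OF W(2)]] by auto
  fix n assume n: "n \<in> blk v"
  then have nN: "n \<in> {1..N}" using blk[OF v] by blast
  have "(v, w) \<in> slots n" using v w n by (simp add: slots_def)
  then have "answer \<Psi> (store W n) (v, w) = answer \<Psi> (store W' n) (v, w)"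
    using fun_cong[OF eq[OF nN], of "(v, w)"] stored_contents[OF W(1) nN] stored_contents[OF
        W(2) nN]
    by (simp add: server_query_def)
  then show "(\<Oplus>k\<in>{1..K}. G k n \<otimes> answer \<Psi> (column W k) (v, w)) =
      (\<Oplus>k\<in>{1..K}. G k n \<otimes> answer \<Psi> (column W' k) (v, w))"
    by (simp only: answer_stored[OF \<Psi> t W(1) nN] answer_stored[OF \<Psi> t W(2) nN])
qed (use k in simp_all)

section \<open>Random queries and correctness\<close>

definition mix :: "nat \<Rightarrow> (nat \<Rightarrow> (nat \<Rightarrow> 'a) \<Rightarrow> slot \<Rightarrow> 'a) \<Rightarrow> nat \<Rightarrow> (nat \<Rightarrow> 'a) \<Rightarrow> slot \<Rightarrow> 'a" where
  "mix i P j = compose (vec {1..L}) (coded i j) (P j)"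

definition rand :: "(nat \<Rightarrow> (nat \<Rightarrow> 'a) \<Rightarrow> slot \<Rightarrow> 'a) set" where
  "rand = (\<Pi>\<^sub>E j\<in>{1..M}. lin_iso {1..L} (idx j))"

lemma randD: "P \<in> rand \<Longrightarrow> j \<in> {1..M} \<Longrightarrow> P j \<in> lin_iso {1..L} (idx j)"
  unfolding rand_def by (rule PiE_mem)

lemma rand_lin: "P \<in> rand \<Longrightarrow> j \<in> {1..M} \<Longrightarrow> lin_map {1..L} (idx j) (P j)"
  using randD by (auto simp: lin_iso_def)

lemma mix_lin: "i \<in> {1..M} \<Longrightarrow> P \<in> rand \<Longrightarrow> j \<in> {1..M} \<Longrightarrow> lin_map {1..L} (idx j) (mix i P j)"
  unfolding mix_def by (rule lin_map_compose[OF rand_lin lin_map_coded])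

lemma finite_rand: "finite rand"
  unfolding rand_def by (intro finite_PiE finite_lin_iso finite_carrier) auto

lemma rand_nonempty: "rand \<noteq> {}"
proof -
  have "lin_iso {1..L} (idx j) \<noteq> {}" if "j \<in> {1..M}" for j
    using card_idx[OF that] by (intro lin_iso_nonempty) (auto simp: L_def)
  then show ?thesis by (simp add: rand_def PiE_eq_empty_iff)
qed

text \<open>Column by column: \<open>columns_determined\<close> yields the answers of the virtual
  servers, \<open>decode\<close> the image of the column of file \<open>i\<close> under
  \<open>P i\<close>, and \<open>P i\<close> is injective.\<close>

lemma correct:
  assumes i: "i \<in> {1..M}" and P: "P \<in> rand" and W: "W \<in> all_W" "W' \<in> all_W"
    and eq: "\<And>n. n \<in> {1..N} \<Longrightarrow>
      server_query n (mix i P) (store W n) = server_query n (mix i P) (store W' n)"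
  shows "W i = W' i"
proof -
  have "column W k i = column W' k i" if k: "k \<in> {1..K}" for k
  proof -
    have "P i (column W k i) = P i (column W' k i)"
    proof (rule decode[OF i, where Z = "\<lambda>j. P j (column W k j)" and Z' = "\<lambda>j. P j (column W' k j)"])
      show "P j (column W k j) \<in> vec (idx j)" if "j \<in> {1..M}" for j
        by (rule lin_map_in[OF rand_lin[OF P that] column_in[OF W(1) that k]])
      show "P j (column W' k j) \<in> vec (idx j)" if "j \<in> {1..M}" for j
        by (rule lin_map_in[OF rand_lin[OF P that] column_in[OF W(2) that k]])
      fix v w assume v: "v < b" and w: "w \<in> pos"
      have "answer (mix i P) (column X k) (v, w) = (\<Oplus>j\<in>supp w. coded i j (P j (column X k j))
          (v, w))"
        if X: "X \<in> all_W" for X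
        unfolding answer_def snd_conv
      proof (intro finsum_cong')
        fix j assume j: "j \<in> supp w"
        have cx: "column X k j \<in> vec {1..L}" using column_in[OF X supp_in[OF j] k] .
        then show "mix i P j (column X k j) (v, w) = coded i j (P j (column X k j)) (v, w)"
          unfolding mix_def by (simp add: compose_eq)
      next
        have "coded i j (P j (column X k j)) (v, w) \<in> carrier R" if j: "j \<in> supp w" for j
          using w lin_map_in[OF rand_lin[OF P supp_in[OF j]] column_in[OF X supp_in[OF j] k]]
          by (intro coded_in[OF i v _ j]) (auto simp: pos_def)
        then show "(\<lambda>j. coded i j (P j (column X k j)) (v, w)) \<in> supp w \<rightarrow> carrier R" by blast
      qed simp
      with columns_determined[OF mix_lin[OF i P] W eq v w k] W
      show "(\<Oplus>j\<in>supp w. coded i j (P j (column W k j)) (v, w)) =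
          (\<Oplus>j\<in>supp w. coded i j (P j (column W' k j)) (v, w))"
        by simp
    qed
    then show ?thesis
      using randD[OF P i] column_in[OF W(1) i k] column_in[OF W(2) i k]
      by (auto simp: lin_iso_def bij_betw_def dest: inj_onD)
  qed
  note columns = this
  have eq: "W i l k = W' i l k" if "l \<in> {1..L}" "k \<in> {1..K}" for l k
    using fun_cong[OF columns[OF that(2)], of l] that i by (simp add: column_def)
  have Wi: "X i \<in> {1..L} \<rightarrow>\<^sub>E {1..K} \<rightarrow>\<^sub>E carrier R" if "X \<in> all_W" for X
    using that i unfolding all_files_def by (rule PiE_mem)
  show ?thesis
  proof (rule PiE_ext[OF Wi[OF W(1)] Wi[OF W(2)]])
    fix l assume l: "l \<in> {1..L}"
    show "W i l = W' i l"
      by (rule PiE_ext[OF PiE_mem[OF Wi[OF W(1)] l] PiE_mem[OF Wi[OF W(2)] l]]) (rule eq[OF l])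
  qed
qed

section \<open>Privacy\<close>

lemma exists_superset:
  assumes "T \<subseteq> {..<b}" "card T \<le> D"
  obtains S where "T \<subseteq> S" "S \<subseteq> {..<b}" "card S = D"
  using exists_subset_between[of T D "{..<b}"] assms D_less by auto

text \<open>Composing each \<open>P j\<close> with \<open>adj S \<pi> i j\<close> permutes
  \<open>rand\<close>. On \<open>S\<close>, which contains all virtual servers seen by
  \<open>T\<close>, \<open>adj\<close> agrees with \<open>coded\<close>. So what \<open>T\<close>
  sees is the query built from the permuted choice alone, in which \<open>i\<close> no longer
  occurs.\<close>

lemma private_queries:
  assumes T: "card {v. v < b \<and> T \<inter> blk v \<noteq> {}} \<le> D"
  shows "\<exists>q0. \<forall>i\<in>{1..M}. \<exists>\<sigma>. bij_betw \<sigma> rand rand \<and>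
    (\<forall>P\<in>rand. \<forall>n\<in>T. server_query n (mix i P) = q0 n (\<sigma> P))"
proof -
  have "{v. v < b \<and> T \<inter> blk v \<noteq> {}} \<subseteq> {..<b}" by auto
  \<comment> \<open>The virtual servers seen are enlarged to exactly \<open>D\<close>, the number of
    coordinates on which the code is a bijection.\<close>
  from exists_superset[OF this T] obtain S where
    TS: "{v. v < b \<and> T \<inter> blk v \<noteq> {}} \<subseteq> S" and S: "S \<subseteq> {..<b}" "card S = D" by metis
  have "card ({..<b} - S) = card {D..<b}"
    using S card_Diff_subset[of S "{..<b}"] finite_subset[of S "{..<b}"] by simp
  then obtain \<pi> where \<pi>: "bij_betw \<pi> ({..<b} - S) {D..<b}"
    using finite_same_card_bij[of "{..<b} - S" "{D..<b}"] by auto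
  have "\<exists>\<sigma>. bij_betw \<sigma> rand rand \<and> (\<forall>P\<in>rand. \<forall>n\<in>T. server_query n (mix i P) = server_query n (\<sigma> P))"
    if i: "i \<in> {1..M}" for i
  proof (intro exI conjI ballI)
    let ?\<sigma> = "\<lambda>P. \<lambda>j\<in>{1..M}. compose (vec {1..L}) (adj S \<pi> i j) (P j)"
    have \<sigma>_in: "?\<sigma> P \<in> rand" if "P \<in> rand" for P
      unfolding rand_def restrict_PiE_iff
      by (intro ballI lin_iso_compose[OF randD[OF that] adj_lin_iso[OF S \<pi> i]])
    have "inj_on ?\<sigma> rand"
    proof (rule inj_onI)
      fix P P' assume P: "P \<in> rand" "P' \<in> rand" and eq: "?\<sigma> P = ?\<sigma> P'"
      show "P = P'"
      proof (rule PiE_ext[OF P[unfolded rand_def]])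
        fix j assume j: "j \<in> {1..M}"
        show "P j = P' j"
          using fun_cong[OF eq, of j] j
          by (intro lin_iso_compose_inj[OF randD[OF P(1) j] randD[OF P(2) j] adj_lin_iso[OF S \<pi>
              i]]) simp
      qed
    qed
    moreover have "?\<sigma> ` rand \<subseteq> rand" using \<sigma>_in by blast
    ultimately show "bij_betw ?\<sigma> rand rand"
      using endo_inj_surj[OF finite_rand] by (simp add: bij_betw_def)
    fix P n assume P: "P \<in> rand" and n: "n \<in> T"
    show "server_query n (mix i P) = server_query n (?\<sigma> P)"
      unfolding server_query_def
    proof (intro restrict_ext)
      fix y t assume y: "y \<in> contents" and t: "t \<in> slots n"
      obtain v w where vw: "t = (v, w)" by (cases t)
      have v: "v < b" "v \<in> S" and w: "w \<in> pos" using t n TS by (auto simp: vw slots_def)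
      have yj: "y j \<in> vec {1..L}" if "j \<in> {1..M}" for j
        using y that unfolding contents_def by (rule PiE_mem)
      show "answer (mix i P) y t = answer (?\<sigma> P) y t"
        unfolding answer_def
      proof (intro finsum_cong' refl funcsetI)
        fix j assume "j \<in> supp (snd t)"
        then have j: "j \<in> supp w" "j \<in> {1..M}" using supp_in by (auto simp: vw)
        then have tj: "(v, w) \<in> idx j" using v w supp_idx by (auto simp: pos_def)
        have Py: "P j (y j) \<in> vec (idx j)" using lin_map_in[OF rand_lin[OF P j(2)] yj[OF j(2)]] .
        show "mix i P j (y j) t = ?\<sigma> P j (y j) t"
          using j yj[OF j(2)] tj Py v by (simp add: vw mix_def compose_eq coded_def adj_def)
        show "?\<sigma> P j (y j) t \<in> carrier R"
          using lin_map_in_carrier[OF rand_lin[OF \<sigma>_in[OF P] j(2)] yj[OF j(2)] tj] by (simp add: vw)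
      qed
    qed
  qed
  then show ?thesis by (intro exI[of _ server_query]) blast
qed

section \<open>Uniformity of the answers\<close>

lemma answer_surj:
  assumes i: "i \<in> {1..M}" and P: "P \<in> rand" and n: "n \<in> {1..N}" and r: "r \<in> vec (slots n)"
  obtains W where "W \<in> all_W" "server_query n (mix i P) (store W n) = r"
proof -
  \<comment> \<open>Answers in slots outside \<open>slots n\<close> are irrelevant here and are
    prescribed as zero.\<close>
  obtain Z where Z: "\<And>j. j \<in> {1..M} \<Longrightarrow> Z j \<in> vec (idx j)"
    and Zr: "\<And>v w. v < b \<Longrightarrow> w \<in> pos \<Longrightarrow>
      (\<Oplus>j\<in>supp w. coded i j (Z j) (v, w)) = (if (v, w) \<in> slots n then r (v, w) else \<zero>)"
    by (rule encode[OF i, of "\<lambda>t. if t \<in> slots n then r t else \<zero>"]) (use r in \<open>auto dest: PiE_mem\<close>)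
  have "\<exists>y. y \<in> vec {1..L} \<and> P j y = Z j" if "j \<in> {1..M}" for j
  proof -
    have "P j ` vec {1..L} = vec (idx j)" using randD[OF P that]
        by (simp add: lin_iso_def bij_betw_def)
    then have "Z j \<in> P j ` vec {1..L}" using Z[OF that] by simp
    then obtain y where "Z j = P j y" "y \<in> vec {1..L}" by (rule imageE)
    then show ?thesis by (intro exI[of _ y]) simp
  qed
  then obtain y where y: "\<And>j. j \<in> {1..M} \<Longrightarrow> y j \<in> vec {1..L}" "\<And>j. j \<in> {1..M} \<Longrightarrow> P j (y j) = Z j"
    by metis
  \<comment> \<open>A zero column of \<open>G\<close> would be dependent inside any \<open>K\<close>
    columns containing it, against the MDS property.\<close>
  have "\<exists>k\<in>{1..K}. G k n \<noteq> \<zero>"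
  proof (rule ccontr)
    assume "\<not> (\<exists>k\<in>{1..K}. G k n \<noteq> \<zero>)"
    then have zero: "G k n = \<zero>" if "k \<in> {1..K}" for k using that by blast
    obtain B where B: "{n} \<subseteq> B" "B \<subseteq> {1..N}" "card B = K"
      using exists_subset_between[of "{n}" K "{1..N}"] n K_pos K_le by auto
    let ?c = "\<lambda>m. if m = n then \<one> else \<zero>"
    have "(\<Oplus>m\<in>B. ?c m \<otimes> G k m) = \<zero>" if k: "k \<in> {1..K}" for k
    proof -
      have "?c m \<otimes> G k m = \<zero>" if "m \<in> B" for m
        using that zero[OF k] G_in[OF _ k] B by auto
      then show ?thesis by (simp add: cong: finsum_cong)
    qed
    moreover have "?c \<in> B \<rightarrow> carrier R" by simp
    ultimately have "\<forall>m\<in>B. ?c m = \<zero>" using mds B unfolding mds_matrix_def by blast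
    then show False using B by auto
  qed
  then obtain k0 where k0: "k0 \<in> {1..K}" "G k0 n \<noteq> \<zero>" by blast
  have g: "G k0 n \<in> carrier R" "inv (G k0 n) \<in> carrier R" "inv (G k0 n) \<otimes> G k0 n = \<one>"
    using G_in[OF n k0(1)] k0(2) by (simp_all add: field_Units)
  \<comment> \<open>The desired content \<open>y\<close>, divided by \<open>G k0 n\<close>, is
    placed in column \<open>k0\<close> alone, so that server \<open>n\<close> stores exactly
    \<open>y\<close>.\<close>
  define W where "W = (\<lambda>j\<in>{1..M}. \<lambda>l\<in>{1..L}. \<lambda>k\<in>{1..K}. if k = k0 then y j l \<otimes> inv (G k0 n) else \<zero>)"
  have yl: "y j l \<in> carrier R" if "j \<in> {1..M}" "l \<in> {1..L}" for j l
    using PiE_mem[OF y(1)] that by blast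
  have W: "W \<in> all_W" using yl g by (simp add: all_files_def W_def)
  have Wy: "store W n j = y j" if j: "j \<in> {1..M}" for j
  proof (rule PiE_ext[OF stored_in_vec[OF W n j] y(1)[OF j]])
    fix l assume l: "l \<in> {1..L}"
    have "store W n j l = (\<Oplus>k\<in>{1..K}. W j l k \<otimes> G k n)" using j l by (simp add: stored_def)
    also have "\<dots> = (\<Oplus>k\<in>{1..K}. if k = k0 then y j l else \<zero>)"
      using j l yl[OF j l] g G_in[OF n] by (intro finsum_cong') (auto simp: W_def m_assoc)
    also have "\<dots> = y j l" using k0 yl[OF j l] by (intro finsum_delta) auto
    finally show "store W n j l = y j l" .
  qed
  have "server_query n (mix i P) (store W n) = r"
  proof (rule PiE_ext[OF _ r])
    have slots_sub: "t \<in> {..<b} \<times> pos" if "t \<in> slots n" for t using that by (auto simp: slots_def)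
    show "server_query n (mix i P) (store W n) \<in> vec (slots n)"
      using answer_in[OF mix_lin[OF i P] slots_sub] stored_contents[OF W n] stored_in_vec[OF W n]
      by (simp add: server_query_def)
    fix t assume t: "t \<in> slots n"
    obtain v w where vw: "t = (v, w)" by (cases t)
    have v: "v < b" and w: "w \<in> pos" using slots_sub[OF t] by (auto simp: vw)
    have "server_query n (mix i P) (store W n) t = (\<Oplus>j\<in>supp w. mix i P j (store W n j) (v, w))"
      using t stored_contents[OF W n] by (simp add: server_query_def answer_def vw)
    also have "\<dots> = (\<Oplus>j\<in>supp w. coded i j (Z j) (v, w))"
    proof (intro finsum_cong' refl funcsetI)
      fix j assume j: "j \<in> supp w"
      show "mix i P j (store W n j) (v, w) = coded i j (Z j) (v, w)"
        using supp_in[OF j] y Wy by (simp add: mix_def compose_eq)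
      show "coded i j (Z j) (v, w) \<in> carrier R"
        using w Z[OF supp_in[OF j]] by (intro coded_in[OF i v _ j]) (simp_all add: pos_def)
    qed
    also have "\<dots> = r t" using Zr[OF v w] t by (simp add: vw)
    finally show "server_query n (mix i P) (store W n) t = r t" .
  qed
  with W show ?thesis by (rule that)
qed

text \<open>Additivity of the answers in the files, for the translation argument in
  \<open>uniform\<close>.\<close>

lemma answer_add:
  assumes i: "i \<in> {1..M}" and P: "P \<in> rand" and n: "n \<in> {1..N}"
    and W: "W \<in> all_W" "V \<in> all_W" and t: "t \<in> slots n"
  defines "X \<equiv> \<lambda>j\<in>{1..M}. \<lambda>l\<in>{1..L}. \<lambda>k\<in>{1..K}. W j l k \<oplus> V j l k"
  shows "X \<in> all_W" "server_query n (mix i P) (store X n) t =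
    server_query n (mix i P) (store W n) t \<oplus> server_query n (mix i P) (store V n) t"
proof -
  show X: "X \<in> all_W" using files_in[OF W(1)] files_in[OF W(2)] by (simp add: X_def all_files_def)
  have "store X n j = (\<lambda>l\<in>{1..L}. store W n j l \<oplus> \<one> \<otimes> store V n j l)" if j: "j \<in> {1..M}" for j
  proof (rule PiE_ext[OF stored_in_vec[OF X n j]])
    show "(\<lambda>l\<in>{1..L}. store W n j l \<oplus> \<one> \<otimes> store V n j l) \<in> vec {1..L}"
      using PiE_mem[OF stored_in_vec[OF W(1) n j]] PiE_mem[OF stored_in_vec[OF W(2) n j]] by auto
    fix l assume l: "l \<in> {1..L}"
    note f = files_in[OF W(1) j l] files_in[OF W(2) j l] G_in[OF n]
    have "store X n j l = (\<Oplus>k\<in>{1..K}. W j l k \<otimes> G k n \<oplus> V j l k \<otimes> G k n)"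
    proof -
      have "store X n j l = (\<Oplus>k\<in>{1..K}. X j l k \<otimes> G k n)" using j l by (simp add: stored_def)
      also have "\<dots> = (\<Oplus>k\<in>{1..K}. W j l k \<otimes> G k n \<oplus> V j l k \<otimes> G k n)"
        using j l f by (intro finsum_cong') (auto simp: X_def l_distr)
      finally show ?thesis .
    qed
    also have "\<dots> = store W n j l \<oplus> store V n j l"
      using j l f by (simp add: stored_def)
    finally show "store X n j l = (\<lambda>l\<in>{1..L}. store W n j l \<oplus> \<one> \<otimes> store V n j l) l"
      using l PiE_mem[OF stored_in_vec[OF W(2) n j]] by simp
  qed
  then have \<Psi>X: "mix i P j (store X n j) =
      (\<lambda>t\<in>idx j. mix i P j (store W n j) t \<oplus> \<one> \<otimes> mix i P j (store V n j) t)" if "j \<in> {1..M}" for j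
    using lin_map_add[OF mix_lin[OF i P that] stored_in_vec[OF W(1) n that] stored_in_vec[OF
        W(2) n that] one_closed] that
    by simp
  have tj: "t \<in> idx j" if "j \<in> supp (snd t)" for j
    using t supp_idx[of "fst t" "snd t" j] that by (auto simp: pos_def slots_def)
  have c: "mix i P j (store Y n j) t \<in> carrier R" if "j \<in> supp (snd t)" "Y \<in> all_W" for j Y
    using lin_map_in_carrier[OF mix_lin[OF i P supp_in[OF that(1)]] stored_in_vec[OF that(2) n
        supp_in[OF that(1)]] tj[OF that(1)]] .
  have "answer (mix i P) (store X n) t = (\<Oplus>j\<in>supp (snd t). mix i P j (store W n j) t \<oplus> mix i P j
      (store V n j) t)"
    unfolding answer_def using c W \<Psi>X supp_in tj by (intro finsum_cong') auto
  also have "\<dots> = answer (mix i P) (store W n) t \<oplus> answer (mix i P) (store V n) t"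
    unfolding answer_def using c W by (intro finsum_addf) auto
  finally show "server_query n (mix i P) (store X n) t =
      server_query n (mix i P) (store W n) t \<oplus> server_query n (mix i P) (store V n) t"
    using t stored_contents[OF X n] stored_contents[OF W(1) n] stored_contents[OF W(2) n]
    by (simp add: server_query_def)
qed

lemma server_query_in:
  assumes i: "i \<in> {1..M}" and P: "P \<in> rand" and n: "n \<in> {1..N}" and W: "W \<in> all_W"
  shows "server_query n (mix i P) (store W n) \<in> vec (slots n)"
proof -
  have "t \<in> {..<b} \<times> pos" if "t \<in> slots n" for t using that by (auto simp: slots_def)
  then show ?thesis
    using answer_in[OF mix_lin[OF i P]] stored_contents[OF W n] stored_in_vec[OF W n]
    by (simp add: server_query_def)
qed

text \<open>Translation of the files by \<open>V = Y - X\<close> maps the fibre of the answer to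
  \<open>X\<close> injectively into that of \<open>Y\<close>, because answers are additive. Together
  with surjectivity this gives the uniform law on all of \<open>vec (slots n)\<close>.\<close>

lemma uniform:
  assumes i: "i \<in> {1..M}" and P: "P \<in> rand" and n: "n \<in> {1..N}"
  shows "map_pmf (\<lambda>W. server_query n (mix i P) (store W n)) (pmf_of_set all_W) =
    pmf_of_set (vec (slots n))"
proof (rule map_pmf_of_set_uniform)
  let ?r = "\<lambda>W. server_query n (mix i P) (store W n)"
  show "finite all_W" by (rule finite_all_files[OF finite_carrier])
  have "(\<lambda>j\<in>{1..M}. \<lambda>l\<in>{1..L}. \<lambda>k\<in>{1..K}. \<zero>) \<in> all_W" by (simp add: all_files_def)
  then show "all_W \<noteq> {}" by blast
  show "?r ` all_W = vec (slots n)"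
    using server_query_in[OF i P n] answer_surj[OF i P n] by blast
  fix X Y assume X: "X \<in> all_W" and Y: "Y \<in> all_W"
  let ?add = "\<lambda>W V. \<lambda>j\<in>{1..M}. \<lambda>l\<in>{1..L}. \<lambda>k\<in>{1..K}. W j l k \<oplus> V j l k"
  define V where "V = (\<lambda>j\<in>{1..M}. \<lambda>l\<in>{1..L}. \<lambda>k\<in>{1..K}. Y j l k \<ominus> X j l k)"
  have V: "V \<in> all_W" using files_in[OF X] files_in[OF Y] by (simp add: V_def all_files_def)
  have ext: "A = B" if "A \<in> all_W" "B \<in> all_W" "\<And>j l k. j \<in> {1..M} \<Longrightarrow> l \<in> {1..L} \<Longrightarrow> k \<in> {1..K} \<Longrightarrow>
      A j l k = B j l k" for A B
  proof -
    note A = that(1)[unfolded all_files_def] and B = that(2)[unfolded all_files_def]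
    show ?thesis
    proof (rule PiE_ext[OF A B])
      fix j assume j: "j \<in> {1..M}"
      show "A j = B j"
      proof (rule PiE_ext[OF PiE_mem[OF A j] PiE_mem[OF B j]])
        fix l assume l: "l \<in> {1..L}"
        show "A j l = B j l"
          by (rule PiE_ext[OF PiE_mem[OF PiE_mem[OF A j] l] PiE_mem[OF PiE_mem[OF B j] l]])
            (rule that(3)[OF j l])
      qed
    qed
  qed
  have add_in: "?add W V \<in> all_W" if "W \<in> all_W" for W
    using files_in[OF that] files_in[OF V] by (simp add: all_files_def)
  have XV: "?add X V = Y"
  proof (rule ext[OF add_in[OF X] Y])
    fix j l k assume *: "j \<in> {1..M}" "l \<in> {1..L}" "k \<in> {1..K}"
    then show "?add X V j l k = Y j l k"
      using files_in[OF X *] files_in[OF Y *] by (simp add: V_def minus_eq a_comm[of "Y j l k"]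
          r_neg2)
  qed
  show "\<exists>\<tau>. inj_on \<tau> {W\<in>all_W. ?r W = ?r X} \<and> \<tau> ` {W\<in>all_W. ?r W = ?r X} \<subseteq> {W\<in>all_W. ?r W = ?r Y}"
  proof (intro exI conjI)
    show "inj_on (\<lambda>W. ?add W V) {W\<in>all_W. ?r W = ?r X}"
    proof (rule inj_onI)
      fix A B assume "A \<in> {W\<in>all_W. ?r W = ?r X}" "B \<in> {W\<in>all_W. ?r W = ?r X}"
          and eq: "?add A V = ?add B V"
      then have A: "A \<in> all_W" and B: "B \<in> all_W" by auto
      show "A = B"
      proof (rule ext[OF A B])
        fix j l k assume *: "j \<in> {1..M}" "l \<in> {1..L}" "k \<in> {1..K}"
        have "A j l k \<oplus> V j l k = B j l k \<oplus> V j l k"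
          using fun_cong[OF fun_cong[OF fun_cong[OF eq, of j], of l], of k] * by simp
        then show "A j l k = B j l k"
          using files_in[OF A *] files_in[OF B *] files_in[OF V *] by simp
      qed
    qed
    show "(\<lambda>W. ?add W V) ` {W\<in>all_W. ?r W = ?r X} \<subseteq> {W\<in>all_W. ?r W = ?r Y}"
    proof (intro image_subsetI CollectI conjI)
      fix W assume "W \<in> {W\<in>all_W. ?r W = ?r X}"
      then have W: "W \<in> all_W" and eq: "?r W = ?r X" by auto
      show "?add W V \<in> all_W" by (rule add_in[OF W])
      show "?r (?add W V) = ?r Y"
      proof (rule PiE_ext[OF server_query_in[OF i P n add_in[OF W]] server_query_in[OF i P n Y]])
        fix t assume t: "t \<in> slots n"
        have "?r (?add W V) t = ?r W t \<oplus> ?r V t" by (rule answer_add(2)[OF i P n W V t])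
        also have "\<dots> = ?r (?add X V) t" unfolding eq by
            (rule answer_add(2)[OF i P n X V t, symmetric])
        finally show "?r (?add W V) t = ?r Y t" unfolding XV .
      qed
    qed
  qed
qed

section \<open>Download size and rate\<close>

lemma card_slots_sum: "(\<Sum>n=1..N. card (slots n)) = b * K * card pos"
proof -
  have "(\<Sum>n=1..N. card {v. v < b \<and> n \<in> blk v}) = (\<Sum>n=1..N. \<Sum>v\<in>{v\<in>{..<b}. n \<in> blk v}. 1)"
    by simp
  also have "\<dots> = (\<Sum>v<b. \<Sum>n\<in>{n\<in>{1..N}. n \<in> blk v}. 1)"
    by (rule sum.swap_restrict) auto
  also have "\<dots> = (\<Sum>v<b. K)"
  proof (rule sum.cong)
    fix v assume "v \<in> {..<b}"
    then have "{n\<in>{1..N}. n \<in> blk v} = blk v" "card (blk v) = K" using blk[of v] by auto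
    then show "(\<Sum>n\<in>{n\<in>{1..N}. n \<in> blk v}. 1) = K" by (simp only: card_eq_sum[symmetric])
  qed simp
  finally show ?thesis
    by (simp add: slots_def card_cartesian_product sum_distrib_right[symmetric])
qed

lemma rate_eq:
  "real (L * K) / real (b * K * card pos) = 1 / (\<Sum>j<M. (real D / real b) ^ j)"
proof -
  let ?R = "real D / real b"
  have b: "real b > 0" and K: "real K > 0" using D_less K_pos by auto
  \<comment> \<open>Here \<open>1 \<le> M\<close> matters; the strict inequality keeps the
    denominator of the rate from vanishing.\<close>
  have "D ^ M < b ^ M" using D_less M_pos by (intro power_strict_mono) auto
  then have pos: "real (card pos) = real b ^ M - real D ^ M" "real b ^ M - real D ^ M > 0"
    by (simp_all add: card_pos of_nat_diff flip: of_nat_power)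
  \<comment> \<open>The geometric sum; its ratio differs from 1 because
    \<open>D < b\<close>.\<close>
  have "(\<Sum>j<M. ?R ^ j) = (1 - ?R ^ M) / (1 - ?R)"
    using D_less by (subst sum_gp_strict) auto
  also have "1 - ?R ^ M = (real b ^ M - real D ^ M) / real b ^ M"
    using b by (simp add: power_divide diff_divide_distrib)
  also have "1 - ?R = (real b - real D) / real b" using b by (simp add: diff_divide_distrib)
  finally have sum: "(\<Sum>j<M. ?R ^ j) = (real b ^ M - real D ^ M) * real b / (real b ^ M *
      (real b - real D))"
    by simp
  have "L = (b - D) * b ^ M"
    unfolding L_def using M_pos by (cases M) auto
  then have "real L = (real b - real D) * real b ^ M"
    using D_less by (simp add: of_nat_diff)
  then have "real (L * K) / real (b * K * card pos) =
      ((real b - real D) * real b ^ M * real K) / (real b * real K * (real b ^ M - real D ^ M))"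
    by (simp only: of_nat_mult pos)
  also have "\<dots> = 1 / (\<Sum>j<M. ?R ^ j)"
    unfolding sum using b K pos D_less by (simp add: mult.commute)
  finally show ?thesis .
qed

end

section \<open>Achievability of the rate\<close>

theorem theorem5:
  fixes N K M b \<Delta> :: nat
    and \<TT> \<BB> :: "nat set set"
  assumes "1 \<le> N" and "1 \<le> K" and "1 \<le> M" and "K \<le> N"
    and "collusion_pattern N \<TT>"
    and "\<forall>B\<in>\<BB>. B \<subseteq> {1..N} \<and> card B = K"
    and "card \<BB> = b"
    and "\<forall>T\<in>\<TT>. card {B \<in> \<BB>. T \<inter> B \<noteq> {}} \<le> \<Delta>"
    and "b > \<Delta>"
  shows "\<exists>q0 :: nat. \<forall>(F :: 'a ring) G.
           field F \<and> finite (carrier F) \<and> card (carrier F) \<ge> q0 \<and> mds_matrix F N K G \<longrightarrow>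
           (\<exists>L\<ge>1. \<exists>s :: (nat, nat, nat, nat, 'a) pir_scheme.
              is_pir_scheme F N K M L G \<TT> s \<and>
              (\<forall>i\<in>{1..M}. pir_rate F N K M L G s i = 1 / (\<Sum>j<M. (real \<Delta> / real b) ^ j)))"
\<comment> \<open>A field with at least \<open>b\<close> elements suffices: the code for the
  unwanted files needs \<open>b\<close> distinct evaluation points.\<close>
proof (rule exI[of _ b], intro allI impI, elim conjE)
  fix F :: "'a ring" and G
  assume F: "field F" "finite (carrier F)" "b \<le> card (carrier F)" and G: "mds_matrix F N K G"
  interpret field F by fact
  \<comment> \<open>An infinite family would have cardinality 0, whereas \<open>b > \<Delta>\<close>
    makes \<open>b\<close> positive.\<close>
  have "finite \<BB>" using assms(7,9) by (intro card_ge_0_finite) simp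
  then obtain blk where blk_bij: "bij_betw blk {..<b} \<BB>"
    using ex_bij_betw_nat_finite[of \<BB>] assms(7) by (auto simp: atLeast0LessThan)
  have blk_in: "blk v \<in> \<BB>" if "v < b" for v using blk_bij that by (auto simp: bij_betw_def)
  obtain \<alpha> where \<alpha>: "\<alpha> ` {..<b} \<subseteq> carrier F" "inj_on \<alpha> {..<b}"
    using card_le_inj[of "{..<b}" "carrier F"] F by auto
  \<comment> \<open>The code for the unwanted files is the Reed-Solomon code of length
    \<open>b\<close> and dimension \<open>\<Delta>\<close> with evaluation points
    \<open>\<alpha> v\<close>.\<close>
  interpret block_scheme F N K M b \<Delta> G blk "\<lambda>v d. \<alpha> v [^]\<^bsub>F\<^esub> d"
  proof unfold_locales
    show "\<alpha> v [^]\<^bsub>F\<^esub> d \<in> carrier F" if "v < b" for v and d :: nat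
      using \<alpha>(1) that by (intro nat_pow_closed) auto
    fix S assume S: "S \<subseteq> {..<b}" "card S = \<Delta>"
    show "\<forall>c\<in>{..<\<Delta>} \<rightarrow> carrier F. (\<forall>v\<in>S. (\<Oplus>\<^bsub>F\<^esub>d\<in>{..<\<Delta>}. c d \<otimes>\<^bsub>F\<^esub> \<alpha> v [^]\<^bsub>F\<^esub> d) = \<zero>\<^bsub>F\<^esub>) \<longrightarrow>
      (\<forall>d\<in>{..<\<Delta>}. c d = \<zero>\<^bsub>F\<^esub>)"
    proof (intro ballI impI)
      fix c d assume c: "c \<in> {..<\<Delta>} \<rightarrow> carrier F" and d: "d \<in> {..<\<Delta>}"
        and zero: "\<forall>v\<in>S. (\<Oplus>\<^bsub>F\<^esub>d\<in>{..<\<Delta>}. c d \<otimes>\<^bsub>F\<^esub> \<alpha> v [^]\<^bsub>F\<^esub> d) = \<zero>\<^bsub>F\<^esub>"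
      show "c d = \<zero>\<^bsub>F\<^esub>"
      proof (rule power_sums_eq_zero_imp[OF F(2) _ S(2) _ _ c])
        show "finite S" by (rule finite_subset[OF S(1)]) simp
        show "inj_on \<alpha> S" by (rule inj_on_subset[OF \<alpha>(2) S(1)])
        show "\<alpha> \<in> S \<rightarrow> carrier F" using \<alpha>(1) S(1) by blast
      qed (use zero d in auto)
    qed
  qed (use assms F G blk_in in auto)
  \<comment> \<open>The bound by \<open>b\<close> does not give this, since \<open>b\<close> may be
    1; zero and one are distinct in a field.\<close>
  have "card {\<zero>\<^bsub>F\<^esub>, \<one>\<^bsub>F\<^esub>} \<le> card (carrier F)" using F(2) by (intro card_mono) auto
  then have q: "1 < card (carrier F)" by simp
  have "\<exists>s :: (nat, nat, nat, nat, 'a) pir_scheme. is_pir_scheme F N K M L G \<TT> s \<and>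
    (\<forall>i\<in>{1..M}. pir_rate F N K M L G s i = real (L * K) / real (\<Sum>n=1..N. card (slots n)))"
  proof (rule pir_scheme_from_functions[OF F(2) q finite_rand rand_nonempty, where
        q = "\<lambda>i n P. server_query n (mix i P)" and R = "\<lambda>n. vec (slots n)"])
    show "\<TT> \<subseteq> Pow {1..N}" using assms(5) by (simp add: collusion_pattern_def)
    show "W i = W' i" if "i \<in> {1..M}" "P \<in> rand" "W \<in> all_W" "W' \<in> all_W"
      "\<And>n. n \<in> {1..N} \<Longrightarrow> server_query n (mix i P) (store W n) =
          server_query n (mix i P) (store W' n)"
      for i P W W'
      by (rule correct[OF that])
    show "\<exists>q0. \<forall>i\<in>{1..M}. \<exists>\<sigma>. bij_betw \<sigma> rand rand \<and>
      (\<forall>P\<in>rand. \<forall>n\<in>T. server_query n (mix i P) = q0 n (\<sigma> P))" if T: "T \<in> \<TT>" for T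
    proof (rule private_queries)
      let ?V = "{v. v < b \<and> T \<inter> blk v \<noteq> {}}"
      have "inj_on blk ?V"
        using blk_bij by (auto simp: bij_betw_def intro: inj_on_subset)
      then have "card ?V = card (blk ` ?V)" by (rule card_image[symmetric])
      also have "blk ` ?V = {B \<in> \<BB>. T \<inter> B \<noteq> {}}"
        using blk_bij by (auto simp: bij_betw_def)
      finally show "card ?V \<le> \<Delta>" using assms(8) T by simp
    qed
    show "map_pmf (\<lambda>W. server_query n (mix i P) (store W n)) (pmf_of_set all_W) =
        pmf_of_set (vec (slots n))"
      if "i \<in> {1..M}" "n \<in> {1..N}" "P \<in> rand" for i n P
      by (rule uniform[OF that(1,3,2)])
    have "finite (slots n)" for n by (simp add: slots_def)
    then show "finite (vec (slots n)) \<and> card (vec (slots n)) =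
        card (carrier F) ^ card (slots n)" for n
      using F(2) by (simp add: finite_PiE card_PiE)
  qed
  moreover have "1 \<le> L" using assms(9) by (simp add: L_def Suc_le_eq)
  ultimately show "\<exists>L\<ge>1. \<exists>s :: (nat, nat, nat, nat, 'a) pir_scheme. is_pir_scheme F N K M L G \<TT> s \<and>
    (\<forall>i\<in>{1..M}. pir_rate F N K M L G s i = 1 / (\<Sum>j<M. (real \<Delta> / real b) ^ j))"
    unfolding card_slots_sum rate_eq by blast
qed

end
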